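(* Let $(\mathfrak k,\mathfrak g,\pi,\cdot)$ be a crossed module of Leibniz algebras over a field $\Bbbk$. One has a category inclusion $$\mathcal M(\mathfrak k,\mathfrak g)\hookrightarrow\mathcal{YD}_{\mathfrak g^+}^{\mathfrak k^+},\qquad (M,\ast,\delta_0)\mapsto(M,\ast,\delta),$$ where the $\mathfrak g$-action $\ast$ on $M$ is extended to $\mathfrak g^+$ by $m\ast1=m$, and the $\mathfrak k^+$-coaction $\delta$ is given by $\delta(m)=\delta_0(m)+m\otimes1$.
   Context: A (right) Leibniz algebra has a bilinear bracket with $[v,[w,u]]=[[v,w],u]-[[v,u],w]$. An action of $\mathfrak g$ on $M$ is a bilinear map $(m,g)\mapsto m\ast g$ with $m\ast[g,g']=(m\ast g)\ast g'-(m\ast g')\ast g$. A crossed module of Leibniz algebras $(\mathfrak k,\mathfrak g,\pi,\cdot)$ is a Leibniz morphism $\pi\colon\mathfrak k\to\mathfrak g$ and an action $\cdot$ of $\mathfrak g$ on $\mathfrak k$ by derivations with $k\cdot\pi(k')=[k,k']_{\mathfrak k}$, $\pi(k\cdot g)=[\pi(k),g]_{\mathfrak g}$. A representation of $(\mathfrak k,\mathfrak g,\pi,\cdot)$ is a vector space $M$ with a $\mathfrak g$-action $\ast$ and a linear map $\delta_0\colon M\to M\otimes\mathfrak k$ with $(\delta_0\otimes\mathrm{Id}_{\mathfrak k})\circ\delta_0=0$ and $\delta_0(m\ast g)=\delta_0(m)\ast g$, where $(m\otimes k)\ast g=m\otimes k\cdot g+m\ast g\otimes k$. $\mathcal M(\mathfrak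 k,\mathfrak g)$ is the category of representations, with linear maps commuting with $\ast$ and $\delta_0$. $\mathfrak k^+=\mathfrak k\oplus\Bbbk1$, $\mathfrak g^+=\mathfrak g\oplus\Bbbk1$, with brackets extended by $[1,x]=[x,1]=0$. $\mathcal{YD}_{\mathfrak g^+}^{\mathfrak k^+}$ is the category of Yetter-Drinfel'd modules over the braided system $C=\mathfrak k^+$, $A=\mathfrak g^+$ with: $\sigma_{C,C}(1\otimes1)=1\otimes1$, $\sigma_{C,C}(1\otimes k)=1\otimes k+k\otimes1$ for $k\in\mathfrak k$, $\sigma_{C,C}(k\otimes k')=0$ for $k\in\mathfrak k$, $k'\in\mathfrak k^+$; $\sigma_{A,A}(g\otimes g')=g'\otimes g+1\otimes[g,g']$; $\sigma_{C,A}(k\otimes g)=g\otimes k$ if $k=1$ or $g=1$, $\sigma_{C,A}(k\otimes g)=g\otimes k+1\otimes k\cdot g$ for $k\in\mathfrak k,g\in\mathfrak g$. A YD module over $(C,A;\sigma_{C,C},\sigma_{A,A},\sigma_{C,A})$ is $M$ with $\rho\colon M\otimes A\to M$, $\delta\colon M\to M\otimes C$ such that $\rho(\rho\otimes A)=\rho(\rho\otimes A)(M\otimes\sigma_{A,A})$, $(\delta\otimes C)\delta=(M\otimes\sigma_{C,C})(\delta\otimes C)\delta$, $\delta\rho=(\rho\otimes C)(M\otimes\sigma_{C,A})(\delta\otimes A)$; morphisms commute with $\rho$ and $\delta$. A category inclusion is a fully faithful functor injective on objects (acting here as the identity on morphisms). *)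

theory Defs
  imports "Jordan_Normal_Form.Missing_VectorSpace" "HOL-Algebra.AbelCoset"
begin

section \<open>Categories\<close>

text \<open>Hom-sets are indexed by their end points and need not be disjoint; accordingly the
  composition takes the three objects involved as arguments.\<close>

record ('o, 'h) cat =
  Ob :: "'o set"
  Hom :: "'o \<Rightarrow> 'o \<Rightarrow> 'h set"
  Id :: "'o \<Rightarrow> 'h"
  Comp :: "'o \<Rightarrow> 'o \<Rightarrow> 'o \<Rightarrow> 'h \<Rightarrow> 'h \<Rightarrow> 'h"

locale category =
  fixes X :: "('o, 'h) cat"
  assumes Id_in: "a \<in> Ob X \<Longrightarrow> Id X a \<in> Hom X a a"
    and Comp_in: "\<lbrakk>a \<in> Ob X; b \<in> Ob X; c \<in> Ob X; g \<in> Hom X b c; f \<in> Hom X a b\<rbrakk>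
      \<Longrightarrow> Comp X a b c g f \<in> Hom X a c"
    and Id_right: "\<lbrakk>a \<in> Ob X; b \<in> Ob X; f \<in> Hom X a b\<rbrakk> \<Longrightarrow> Comp X a a b f (Id X a) = f"
    and Id_left: "\<lbrakk>a \<in> Ob X; b \<in> Ob X; f \<in> Hom X a b\<rbrakk> \<Longrightarrow> Comp X a b b (Id X b) f = f"
    and Comp_assoc: "\<lbrakk>a \<in> Ob X; b \<in> Ob X; c \<in> Ob X; d \<in> Ob X;
        h \<in> Hom X c d; g \<in> Hom X b c; f \<in> Hom X a b\<rbrakk>
      \<Longrightarrow> Comp X a b d (Comp X b c d h g) f = Comp X a c d h (Comp X a b c g f)"

locale cat_functor = X: category X + Y: category Y
  for X :: "('o, 'h) cat" and Y :: "('p, 'i) cat" +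
  fixes Fo :: "'o \<Rightarrow> 'p" and Fm :: "'o \<Rightarrow> 'o \<Rightarrow> 'h \<Rightarrow> 'i"
  assumes Fo_in: "a \<in> Ob X \<Longrightarrow> Fo a \<in> Ob Y"
    and Fm_in: "\<lbrakk>a \<in> Ob X; b \<in> Ob X; f \<in> Hom X a b\<rbrakk> \<Longrightarrow> Fm a b f \<in> Hom Y (Fo a) (Fo b)"
    and Fm_Id: "a \<in> Ob X \<Longrightarrow> Fm a a (Id X a) = Id Y (Fo a)"
    and Fm_Comp: "\<lbrakk>a \<in> Ob X; b \<in> Ob X; c \<in> Ob X; g \<in> Hom X b c; f \<in> Hom X a b\<rbrakk>
      \<Longrightarrow> Fm a c (Comp X a b c g f) = Comp Y (Fo a) (Fo b) (Fo c) (Fm b c g) (Fm a b f)"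

locale category_inclusion = cat_functor X Y Fo Fm
  for X :: "('o, 'h) cat" and Y :: "('p, 'i) cat" and Fo Fm +
  assumes fully_faithful: "\<lbrakk>a \<in> Ob X; b \<in> Ob X\<rbrakk>
      \<Longrightarrow> bij_betw (Fm a b) (Hom X a b) (Hom Y (Fo a) (Fo b))"
    and inj_on_objects: "inj_on Fo (Ob X)"


section \<open>Tensor products of vector spaces\<close>

definition bilinear_map ::
  "('f, 'x) ring_scheme \<Rightarrow> ('f, 'u, 'y) module_scheme \<Rightarrow> ('f, 'v, 'z) module_scheme
    \<Rightarrow> ('f, 'w, 't) module_scheme \<Rightarrow> ('u \<Rightarrow> 'v \<Rightarrow> 'w) \<Rightarrow> bool" where
  "bilinear_map F U V W \<beta> \<longleftrightarrow>
     (\<forall>u\<in>carrier U. \<beta> u \<in> module_hom F V W) \<and>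
     (\<forall>v\<in>carrier V. (\<lambda>u. \<beta> u v) \<in> module_hom F U W)"

definition free_module :: "('f, 'x) ring_scheme \<Rightarrow> 's set \<Rightarrow> ('f, 's \<Rightarrow> 'f) module" where
  "free_module F S = (ring.func_space F S)
     \<lparr>carrier := {f \<in> S \<rightarrow>\<^sub>E carrier F. finite {s \<in> S. f s \<noteq> \<zero>\<^bsub>F\<^esub>}}\<rparr>"

definition free_gen :: "('f, 'x) ring_scheme \<Rightarrow> 's set \<Rightarrow> 's \<Rightarrow> 's \<Rightarrow> 'f" where
  "free_gen F S s = (\<lambda>t\<in>S. if t = s then \<one>\<^bsub>F\<^esub> else \<zero>\<^bsub>F\<^esub>)"

text \<open>The ring part of a module record is irrelevant; \<open>mult\<close> and \<open>one\<close> are filled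
  as in \<open>direct_sum\<close>.\<close>

definition quotient_module :: "('f, 'v, 'y) module_scheme \<Rightarrow> 'v set \<Rightarrow> ('f, 'v set) module" where
  "quotient_module V W = \<lparr>carrier = a_rcosets\<^bsub>V\<^esub> W,
     mult = (\<lambda>X Y. W), one = W, zero = W,
     add = (\<lambda>X Y. X <+>\<^bsub>V\<^esub> Y),
     smult = (\<lambda>c X. \<Union>x\<in>X. W +>\<^bsub>V\<^esub> (c \<odot>\<^bsub>V\<^esub> x))\<rparr>"

definition tensor_rels :: "('f, 'x) ring_scheme \<Rightarrow> ('f, 'u, 'y) module_scheme
    \<Rightarrow> ('f, 'v, 'z) module_scheme \<Rightarrow> ('u \<times> 'v \<Rightarrow> 'f) set" where
  "tensor_rels F U V =
    (let S = carrier U \<times> carrier V; L = free_module F S; e = (\<lambda>u v. free_gen F S (u, v)) in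
      {e (u \<oplus>\<^bsub>U\<^esub> u') v \<ominus>\<^bsub>L\<^esub> (e u v \<oplus>\<^bsub>L\<^esub> e u' v) | u u' v.
         u \<in> carrier U \<and> u' \<in> carrier U \<and> v \<in> carrier V} \<union>
      {e u (v \<oplus>\<^bsub>V\<^esub> v') \<ominus>\<^bsub>L\<^esub> (e u v \<oplus>\<^bsub>L\<^esub> e u v') | u v v'.
         u \<in> carrier U \<and> v \<in> carrier V \<and> v' \<in> carrier V} \<union>
      {e (c \<odot>\<^bsub>U\<^esub> u) v \<ominus>\<^bsub>L\<^esub> c \<odot>\<^bsub>L\<^esub> e u v | c u v.
         c \<in> carrier F \<and> u \<in> carrier U \<and> v \<in> carrier V} \<union>
      {e u (c \<odot>\<^bsub>V\<^esub> v) \<ominus>\<^bsub>L\<^esub> c \<odot>\<^bsub>L\<^esub> e u v | c u v.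
         c \<in> carrier F \<and> u \<in> carrier U \<and> v \<in> carrier V})"

definition tensor_null :: "('f, 'x) ring_scheme \<Rightarrow> ('f, 'u, 'y) module_scheme
    \<Rightarrow> ('f, 'v, 'z) module_scheme \<Rightarrow> ('u \<times> 'v \<Rightarrow> 'f) set" where
  "tensor_null F U V =
     LinearCombinations.module.span F (free_module F (carrier U \<times> carrier V)) (tensor_rels F U V)"

definition tensor :: "('f, 'x) ring_scheme \<Rightarrow> ('f, 'u, 'y) module_scheme
    \<Rightarrow> ('f, 'v, 'z) module_scheme \<Rightarrow> ('f, ('u \<times> 'v \<Rightarrow> 'f) set) module" where
  "tensor F U V =
     quotient_module (free_module F (carrier U \<times> carrier V)) (tensor_null F U V)"

definition pure :: "('f, 'x) ring_scheme \<Rightarrow> ('f, 'u, 'y) module_scheme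
    \<Rightarrow> ('f, 'v, 'z) module_scheme \<Rightarrow> 'u \<Rightarrow> 'v \<Rightarrow> ('u \<times> 'v \<Rightarrow> 'f) set" where
  "pure F U V u v = tensor_null F U V +>\<^bsub>free_module F (carrier U \<times> carrier V)\<^esub>
     free_gen F (carrier U \<times> carrier V) (u, v)"

text \<open>The linear map determined by its values on a spanning set, as described by \<open>P\<close>. It is made extensional (undefined
  outside the domain) so that it is unique as a HOL function.\<close>

definition the_linear :: "('f, 'x) ring_scheme \<Rightarrow> ('f, 'u, 'y) module_scheme
    \<Rightarrow> ('f, 'v, 'z) module_scheme \<Rightarrow> (('u \<Rightarrow> 'v) \<Rightarrow> bool) \<Rightarrow> 'u \<Rightarrow> 'v" where
  "the_linear F U V P = (THE h. h \<in> extensional (carrier U) \<and> linear_map F U V h \<and> P h)"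

definition tensor_map :: "('f, 'x) ring_scheme
    \<Rightarrow> ('f, 'u, 'y) module_scheme \<Rightarrow> ('f, 'v, 'z) module_scheme
    \<Rightarrow> ('f, 'u', 'y') module_scheme \<Rightarrow> ('f, 'v', 'z') module_scheme
    \<Rightarrow> ('u \<Rightarrow> 'u') \<Rightarrow> ('v \<Rightarrow> 'v') \<Rightarrow> ('u \<times> 'v \<Rightarrow> 'f) set \<Rightarrow> ('u' \<times> 'v' \<Rightarrow> 'f) set" where
  "tensor_map F U V U' V' f g = the_linear F (tensor F U V) (tensor F U' V')
     (\<lambda>h. \<forall>u\<in>carrier U. \<forall>v\<in>carrier V. h (pure F U V u v) = pure F U' V' (f u) (g v))"

definition tensor_assoc :: "('f, 'x) ring_scheme \<Rightarrow> ('f, 'u, 'y) module_scheme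
    \<Rightarrow> ('f, 'v, 'z) module_scheme \<Rightarrow> ('f, 'w, 't) module_scheme
    \<Rightarrow> (('u \<times> 'v \<Rightarrow> 'f) set \<times> 'w \<Rightarrow> 'f) set \<Rightarrow> ('u \<times> ('v \<times> 'w \<Rightarrow> 'f) set \<Rightarrow> 'f) set" where
  "tensor_assoc F U V W = the_linear F (tensor F (tensor F U V) W) (tensor F U (tensor F V W))
     (\<lambda>h. \<forall>u\<in>carrier U. \<forall>v\<in>carrier V. \<forall>w\<in>carrier W.
        h (pure F (tensor F U V) W (pure F U V u v) w)
          = pure F U (tensor F V W) u (pure F V W v w))"

definition tensor_assoc_inv :: "('f, 'x) ring_scheme \<Rightarrow> ('f, 'u, 'y) module_scheme
    \<Rightarrow> ('f, 'v, 'z) module_scheme \<Rightarrow> ('f, 'w, 't) module_scheme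
    \<Rightarrow> ('u \<times> ('v \<times> 'w \<Rightarrow> 'f) set \<Rightarrow> 'f) set \<Rightarrow> (('u \<times> 'v \<Rightarrow> 'f) set \<times> 'w \<Rightarrow> 'f) set" where
  "tensor_assoc_inv F U V W =
     the_linear F (tensor F U (tensor F V W)) (tensor F (tensor F U V) W)
     (\<lambda>h. \<forall>u\<in>carrier U. \<forall>v\<in>carrier V. \<forall>w\<in>carrier W.
        h (pure F U (tensor F V W) u (pure F V W v w))
          = pure F (tensor F U V) W (pure F U V u v) w)"

text \<open>For \<open>\<sigma> : V \<otimes> W \<rightarrow> V' \<otimes> W'\<close>, the map \<open>U \<otimes> \<sigma>\<close>, read as a map
  \<open>(U \<otimes> V) \<otimes> W \<rightarrow> (U \<otimes> V') \<otimes> W'\<close>.\<close>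

definition tensor_left :: "('f, 'x) ring_scheme \<Rightarrow> ('f, 'u, 'y) module_scheme
    \<Rightarrow> ('f, 'v, 'z) module_scheme \<Rightarrow> ('f, 'w, 't) module_scheme
    \<Rightarrow> ('f, 'v', 'z') module_scheme \<Rightarrow> ('f, 'w', 't') module_scheme
    \<Rightarrow> (('v \<times> 'w \<Rightarrow> 'f) set \<Rightarrow> ('v' \<times> 'w' \<Rightarrow> 'f) set)
    \<Rightarrow> (('u \<times> 'v \<Rightarrow> 'f) set \<times> 'w \<Rightarrow> 'f) set \<Rightarrow> (('u \<times> 'v' \<Rightarrow> 'f) set \<times> 'w' \<Rightarrow> 'f) set" where
  "tensor_left F U V W V' W' \<sigma> t =
     tensor_assoc_inv F U V' W'
       (tensor_map F U (tensor F V W) U (tensor F V' W') (\<lambda>u. u) \<sigma> (tensor_assoc F U V W t))"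


section \<open>Leibniz algebras and their crossed modules\<close>

record ('f, 'v) leibniz = "('f, 'v) module" +
  bracket :: "'v \<Rightarrow> 'v \<Rightarrow> 'v"

locale leibniz_algebra = vectorspace F L
  for F :: "('f, 'x) ring_scheme" and L :: "('f, 'v, 'y) leibniz_scheme" +
  assumes bracket_bilinear: "bilinear_map F L L L (bracket L)"
    and leibniz: "\<lbrakk>v \<in> carrier L; w \<in> carrier L; u \<in> carrier L\<rbrakk> \<Longrightarrow>
      bracket L v (bracket L w u)
        = bracket L (bracket L v w) u \<ominus>\<^bsub>L\<^esub> bracket L (bracket L v u) w"

definition leibniz_action :: "('f, 'x) ring_scheme \<Rightarrow> ('f, 'g, 'y) leibniz_scheme
    \<Rightarrow> ('f, 'm, 'z) module_scheme \<Rightarrow> ('m \<Rightarrow> 'g \<Rightarrow> 'm) \<Rightarrow> bool" where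
  "leibniz_action F G M a \<longleftrightarrow> bilinear_map F M G M a \<and>
     (\<forall>m\<in>carrier M. \<forall>g\<in>carrier G. \<forall>g'\<in>carrier G.
        a m (bracket G g g') = a (a m g) g' \<ominus>\<^bsub>M\<^esub> a (a m g') g)"

locale crossed_module = K: leibniz_algebra F K + G: leibniz_algebra F G
  for F :: "('f, 'x) ring_scheme" and K :: "('f, 'k) leibniz" and G :: "('f, 'g) leibniz" +
  fixes \<pi> :: "'k \<Rightarrow> 'g" and act :: "'k \<Rightarrow> 'g \<Rightarrow> 'k"
  assumes pi_linear: "linear_map F K G \<pi>"
    and pi_bracket: "\<lbrakk>k \<in> carrier K; k' \<in> carrier K\<rbrakk> \<Longrightarrow>
      \<pi> (bracket K k k') = bracket G (\<pi> k) (\<pi> k')"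
    and act_action: "leibniz_action F G K act"
    and act_derivation: "\<lbrakk>k \<in> carrier K; k' \<in> carrier K; g \<in> carrier G\<rbrakk> \<Longrightarrow>
      act (bracket K k k') g = bracket K (act k g) k' \<oplus>\<^bsub>K\<^esub> bracket K k (act k' g)"
    and act_pi: "\<lbrakk>k \<in> carrier K; k' \<in> carrier K\<rbrakk> \<Longrightarrow> act k (\<pi> k') = bracket K k k'"
    and pi_act: "\<lbrakk>k \<in> carrier K; g \<in> carrier G\<rbrakk> \<Longrightarrow> \<pi> (act k g) = bracket G (\<pi> k) g"


section \<open>Representations of a crossed module\<close>

record ('f, 'm, 'k, 'g) rep =
  rep_space :: "('f, 'm) module"
  rep_act :: "'m \<times> 'g \<Rightarrow> 'm"
  rep_coact :: "'m \<Rightarrow> ('m \<times> 'k \<Rightarrow> 'f) set"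

definition diagonal_act :: "('f, 'x) ring_scheme \<Rightarrow> ('f, 'm, 'z) module_scheme
    \<Rightarrow> ('f, 'k, 'y) module_scheme \<Rightarrow> ('m \<times> 'g \<Rightarrow> 'm) \<Rightarrow> ('k \<Rightarrow> 'g \<Rightarrow> 'k)
    \<Rightarrow> ('m \<times> 'k \<Rightarrow> 'f) set \<Rightarrow> 'g \<Rightarrow> ('m \<times> 'k \<Rightarrow> 'f) set" where
  "diagonal_act F M K a act t g = the_linear F (tensor F M K) (tensor F M K)
     (\<lambda>h. \<forall>m\<in>carrier M. \<forall>k\<in>carrier K.
        h (pure F M K m k) = pure F M K m (act k g) \<oplus>\<^bsub>tensor F M K\<^esub> pure F M K (a (m, g)) k) t"

text \<open>The structure maps are extensional, so that two objects with the same underlying vector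
  space are equal iff their actions and coactions agree.\<close>

definition is_rep :: "('f, 'x) ring_scheme \<Rightarrow> ('f, 'k) leibniz \<Rightarrow> ('f, 'g) leibniz
    \<Rightarrow> ('k \<Rightarrow> 'g \<Rightarrow> 'k) \<Rightarrow> ('f, 'm, 'k, 'g) rep \<Rightarrow> bool" where
  "is_rep F K G act R \<longleftrightarrow> (let M = rep_space R; a = rep_act R; \<delta>0 = rep_coact R in
     vectorspace F M \<and>
     a \<in> extensional (carrier M \<times> carrier G) \<and> leibniz_action F G M (curry a) \<and>
     \<delta>0 \<in> extensional (carrier M) \<and> linear_map F M (tensor F M K) \<delta>0 \<and>
     (\<forall>m\<in>carrier M. tensor_map F M K (tensor F M K) K \<delta>0 (\<lambda>k. k) (\<delta>0 m)
        = \<zero>\<^bsub>tensor F (tensor F M K) K\<^esub>) \<and>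
     (\<forall>m\<in>carrier M. \<forall>g\<in>carrier G. \<delta>0 (a (m, g)) = diagonal_act F M K a act (\<delta>0 m) g))"

definition rep_hom :: "('f, 'x) ring_scheme \<Rightarrow> ('f, 'k) leibniz \<Rightarrow> ('f, 'g) leibniz
    \<Rightarrow> ('f, 'm, 'k, 'g) rep \<Rightarrow> ('f, 'm, 'k, 'g) rep \<Rightarrow> ('m \<Rightarrow> 'm) set" where
  "rep_hom F K G R R' = (let M = rep_space R; M' = rep_space R' in
     {f \<in> extensional (carrier M). linear_map F M M' f \<and>
        (\<forall>m\<in>carrier M. \<forall>g\<in>carrier G. f (rep_act R (m, g)) = rep_act R' (f m, g)) \<and>
        (\<forall>m\<in>carrier M. rep_coact R' (f m) = tensor_map F M K M' K f (\<lambda>k. k) (rep_coact R m))})"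

text \<open>The category of representations whose underlying sets are subsets of the type
  \<open>'m\<close>.\<close>

definition Rep :: "('f, 'x) ring_scheme \<Rightarrow> ('f, 'k) leibniz \<Rightarrow> ('f, 'g) leibniz
    \<Rightarrow> ('k \<Rightarrow> 'g \<Rightarrow> 'k) \<Rightarrow> (('f, 'm, 'k, 'g) rep, 'm \<Rightarrow> 'm) cat" where
  "Rep F K G act = \<lparr>
     Ob = {R. is_rep F K G act R},
     Hom = rep_hom F K G,
     Id = (\<lambda>R. \<lambda>m\<in>carrier (rep_space R). m),
     Comp = (\<lambda>R R' R'' g f. compose (carrier (rep_space R)) g f)\<rparr>"


section \<open>Yetter-Drinfeld modules over a braided system\<close>

record ('f, 'm, 'c, 'a) yd =
  yd_space :: "('f, 'm) module"
  yd_act :: "('m \<times> 'a \<Rightarrow> 'f) set \<Rightarrow> 'm"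
  yd_coact :: "'m \<Rightarrow> ('m \<times> 'c \<Rightarrow> 'f) set"

definition is_yd :: "('f, 'x) ring_scheme \<Rightarrow> ('f, 'c, 'y) module_scheme \<Rightarrow> ('f, 'a, 'z) module_scheme
    \<Rightarrow> (('c \<times> 'c \<Rightarrow> 'f) set \<Rightarrow> ('c \<times> 'c \<Rightarrow> 'f) set)
    \<Rightarrow> (('a \<times> 'a \<Rightarrow> 'f) set \<Rightarrow> ('a \<times> 'a \<Rightarrow> 'f) set)
    \<Rightarrow> (('c \<times> 'a \<Rightarrow> 'f) set \<Rightarrow> ('a \<times> 'c \<Rightarrow> 'f) set)
    \<Rightarrow> ('f, 'm, 'c, 'a) yd \<Rightarrow> bool" where
  "is_yd F C A \<sigma>CC \<sigma>AA \<sigma>CA Y \<longleftrightarrow> (let M = yd_space Y; \<rho> = yd_act Y; \<delta> = yd_coact Y in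
     vectorspace F M \<and>
     \<rho> \<in> extensional (carrier (tensor F M A)) \<and> linear_map F (tensor F M A) M \<rho> \<and>
     \<delta> \<in> extensional (carrier M) \<and> linear_map F M (tensor F M C) \<delta> \<and>
     (\<forall>t\<in>carrier (tensor F (tensor F M A) A).
        \<rho> (tensor_map F (tensor F M A) A M A \<rho> (\<lambda>a. a) t)
          = \<rho> (tensor_map F (tensor F M A) A M A \<rho> (\<lambda>a. a) (tensor_left F M A A A A \<sigma>AA t))) \<and>
     (\<forall>m\<in>carrier M.
        tensor_map F M C (tensor F M C) C \<delta> (\<lambda>c. c) (\<delta> m)
          = tensor_left F M C C C C \<sigma>CC (tensor_map F M C (tensor F M C) C \<delta> (\<lambda>c. c) (\<delta> m))) \<and>
     (\<forall>t\<in>carrier (tensor F M A).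
        \<delta> (\<rho> t) = tensor_map F (tensor F M A) C M C \<rho> (\<lambda>c. c)
          (tensor_left F M C A A C \<sigma>CA (tensor_map F M A (tensor F M C) A \<delta> (\<lambda>a. a) t))))"

definition yd_hom :: "('f, 'x) ring_scheme \<Rightarrow> ('f, 'c, 'y) module_scheme \<Rightarrow> ('f, 'a, 'z) module_scheme
    \<Rightarrow> ('f, 'm, 'c, 'a) yd \<Rightarrow> ('f, 'm, 'c, 'a) yd \<Rightarrow> ('m \<Rightarrow> 'm) set" where
  "yd_hom F C A Y Y' = (let M = yd_space Y; M' = yd_space Y' in
     {f \<in> extensional (carrier M). linear_map F M M' f \<and>
        (\<forall>t\<in>carrier (tensor F M A). f (yd_act Y t) = yd_act Y' (tensor_map F M A M' A f (\<lambda>a. a) t)) \<and>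
        (\<forall>m\<in>carrier M. yd_coact Y' (f m) = tensor_map F M C M' C f (\<lambda>c. c) (yd_coact Y m))})"

definition YD :: "('f, 'x) ring_scheme \<Rightarrow> ('f, 'c, 'y) module_scheme \<Rightarrow> ('f, 'a, 'z) module_scheme
    \<Rightarrow> (('c \<times> 'c \<Rightarrow> 'f) set \<Rightarrow> ('c \<times> 'c \<Rightarrow> 'f) set)
    \<Rightarrow> (('a \<times> 'a \<Rightarrow> 'f) set \<Rightarrow> ('a \<times> 'a \<Rightarrow> 'f) set)
    \<Rightarrow> (('c \<times> 'a \<Rightarrow> 'f) set \<Rightarrow> ('a \<times> 'c \<Rightarrow> 'f) set)
    \<Rightarrow> (('f, 'm, 'c, 'a) yd, 'm \<Rightarrow> 'm) cat" where
  "YD F C A \<sigma>CC \<sigma>AA \<sigma>CA = \<lparr>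
     Ob = {Y. is_yd F C A \<sigma>CC \<sigma>AA \<sigma>CA Y},
     Hom = yd_hom F C A,
     Id = (\<lambda>Y. \<lambda>m\<in>carrier (yd_space Y). m),
     Comp = (\<lambda>Y Y' Y'' g f. compose (carrier (yd_space Y)) g f)\<rparr>"


section \<open>The braided system of a crossed module\<close>

definition ground_space :: "('f, 'x) ring_scheme \<Rightarrow> ('f, 'f) module" where
  "ground_space F = \<lparr>carrier = carrier F, mult = mult F, one = \<one>\<^bsub>F\<^esub>,
     zero = \<zero>\<^bsub>F\<^esub>, add = add F, smult = mult F\<rparr>"

text \<open>\<open>L\<^sup>+ = L \<oplus> F\<one>\<close>; the pair \<open>(x, c)\<close> stands for \<open>x + c\<one>\<close>.\<close>

definition adjoin_unit :: "('f, 'x) ring_scheme \<Rightarrow> ('f, 'v) leibniz \<Rightarrow> ('f, 'v \<times> 'f) leibniz" where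
  "adjoin_unit F L = module.extend (direct_sum L (ground_space F))
     \<lparr>bracket = (\<lambda>x y. (bracket L (fst x) (fst y), \<zero>\<^bsub>F\<^esub>))\<rparr>"

definition emb :: "('f, 'x) ring_scheme \<Rightarrow> 'v \<Rightarrow> 'v \<times> 'f" where
  "emb F x = (x, \<zero>\<^bsub>F\<^esub>)"

definition unt :: "('f, 'x) ring_scheme \<Rightarrow> ('f, 'v) leibniz \<Rightarrow> 'v \<times> 'f" where
  "unt F L = (\<zero>\<^bsub>L\<^esub>, \<one>\<^bsub>F\<^esub>)"

definition sigma_CC :: "('f, 'x) ring_scheme \<Rightarrow> ('f, 'k) leibniz
    \<Rightarrow> (('k \<times> 'f) \<times> ('k \<times> 'f) \<Rightarrow> 'f) set \<Rightarrow> (('k \<times> 'f) \<times> ('k \<times> 'f) \<Rightarrow> 'f) set" where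
  "sigma_CC F K = (let C = adjoin_unit F K; e = unt F K; CC = tensor F C C; p = pure F C C in
     the_linear F CC CC (\<lambda>h.
       h (p e e) = p e e \<and>
       (\<forall>k\<in>carrier K. h (p e (emb F k)) = p e (emb F k) \<oplus>\<^bsub>CC\<^esub> p (emb F k) e) \<and>
       (\<forall>k\<in>carrier K. \<forall>y\<in>carrier C. h (p (emb F k) y) = \<zero>\<^bsub>CC\<^esub>)))"

definition sigma_AA :: "('f, 'x) ring_scheme \<Rightarrow> ('f, 'g) leibniz
    \<Rightarrow> (('g \<times> 'f) \<times> ('g \<times> 'f) \<Rightarrow> 'f) set \<Rightarrow> (('g \<times> 'f) \<times> ('g \<times> 'f) \<Rightarrow> 'f) set" where
  "sigma_AA F G = (let A = adjoin_unit F G; e = unt F G; AA = tensor F A A; p = pure F A A in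
     the_linear F AA AA (\<lambda>h. \<forall>x\<in>carrier A. \<forall>y\<in>carrier A.
       h (p x y) = p y x \<oplus>\<^bsub>AA\<^esub> p e (bracket A x y)))"

definition sigma_CA :: "('f, 'x) ring_scheme \<Rightarrow> ('f, 'k) leibniz \<Rightarrow> ('f, 'g) leibniz
    \<Rightarrow> ('k \<Rightarrow> 'g \<Rightarrow> 'k)
    \<Rightarrow> (('k \<times> 'f) \<times> ('g \<times> 'f) \<Rightarrow> 'f) set \<Rightarrow> (('g \<times> 'f) \<times> ('k \<times> 'f) \<Rightarrow> 'f) set" where
  "sigma_CA F K G act = (let C = adjoin_unit F K; A = adjoin_unit F G;
       AC = tensor F A C; p = pure F C A; q = pure F A C in
     the_linear F (tensor F C A) AC (\<lambda>h.
       (\<forall>x\<in>carrier C. \<forall>y\<in>carrier A. x = unt F K \<or> y = unt F G \<longrightarrow> h (p x y) = q y x) \<and>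
       (\<forall>k\<in>carrier K. \<forall>g\<in>carrier G.
          h (p (emb F k) (emb F g))
            = q (emb F g) (emb F k) \<oplus>\<^bsub>AC\<^esub> q (unt F G) (emb F (act k g)))))"

definition YD_plus :: "('f, 'x) ring_scheme \<Rightarrow> ('f, 'k) leibniz \<Rightarrow> ('f, 'g) leibniz
    \<Rightarrow> ('k \<Rightarrow> 'g \<Rightarrow> 'k) \<Rightarrow> (('f, 'm, 'k \<times> 'f, 'g \<times> 'f) yd, 'm \<Rightarrow> 'm) cat" where
  "YD_plus F K G act = YD F (adjoin_unit F K) (adjoin_unit F G)
     (sigma_CC F K) (sigma_AA F G) (sigma_CA F K G act)"


section \<open>The inclusion on objects\<close>

definition extend_act :: "('f, 'x) ring_scheme \<Rightarrow> ('f, 'g) leibniz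
    \<Rightarrow> ('f, 'm) module \<Rightarrow> ('m \<times> 'g \<Rightarrow> 'm) \<Rightarrow> ('m \<times> ('g \<times> 'f) \<Rightarrow> 'f) set \<Rightarrow> 'm" where
  "extend_act F G M a = (let A = adjoin_unit F G in
     the_linear F (tensor F M A) M (\<lambda>h. \<forall>m\<in>carrier M.
       h (pure F M A m (unt F G)) = m \<and>
       (\<forall>g\<in>carrier G. h (pure F M A m (emb F g)) = a (m, g))))"

definition extend_coact :: "('f, 'x) ring_scheme \<Rightarrow> ('f, 'k) leibniz
    \<Rightarrow> ('f, 'm) module \<Rightarrow> ('m \<Rightarrow> ('m \<times> 'k \<Rightarrow> 'f) set)
    \<Rightarrow> 'm \<Rightarrow> ('m \<times> ('k \<times> 'f) \<Rightarrow> 'f) set" where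
  "extend_coact F K M \<delta>0 = (let C = adjoin_unit F K in
     (\<lambda>m\<in>carrier M. tensor_map F M K M C (\<lambda>m. m) (emb F) (\<delta>0 m)
       \<oplus>\<^bsub>tensor F M C\<^esub> pure F M C m (unt F K)))"

definition rep_to_yd :: "('f, 'x) ring_scheme \<Rightarrow> ('f, 'k) leibniz \<Rightarrow> ('f, 'g) leibniz
    \<Rightarrow> ('f, 'm, 'k, 'g) rep \<Rightarrow> ('f, 'm, 'k \<times> 'f, 'g \<times> 'f) yd" where
  "rep_to_yd F K G R = \<lparr>
     yd_space = rep_space R,
     yd_act = extend_act F G (rep_space R) (rep_act R),
     yd_coact = extend_coact F K (rep_space R) (rep_coact R)\<rparr>"

end

theory Submission
  imports Defs
begin

text \<open>Write \<open>e\<close> for the adjoined units and \<open>\<iota> : M \<otimes> K \<rightarrow> M \<otimes> K\<^sup>+\<close> for the map induced by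
\<open>K \<subseteq> K\<^sup>+\<close>, so that \<open>\<delta>(m) = \<iota>(\<delta>\<^sub>0(m)) + m \<otimes> e\<close>. In Sweedler notation
\<open>\<delta>\<^sub>0(m) = m\<^sub>0 \<otimes> m\<^sub>1\<close>, the three Yetter-Drinfeld axioms are checked as follows.

\<^item> Action (lemma \<open>\<rho>_braided\<close>). On \<open>m \<otimes> x \<otimes> y\<close> the axiom for \<open>\<sigma>\<^sub>A\<^sub>,\<^sub>A\<close> says
  \<open>(m \<sqdot> x) \<sqdot> y = (m \<sqdot> y) \<sqdot> x + (m \<sqdot> e) \<sqdot> [x, y]\<close>. Since \<open>m \<sqdot> e = m\<close>, this is the Leibniz action
  identity when \<open>x, y \<in> G\<close>; when \<open>x\<close> or \<open>y\<close> is the unit, the bracket vanishes and both sides agree.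

\<^item> Coaction (lemma \<open>\<delta>_braided\<close>). As \<open>(\<delta>\<^sub>0 \<otimes> K) \<circ> \<delta>\<^sub>0 = 0\<close>, the iterated coaction is
  \<open>m\<^sub>0 \<otimes> e \<otimes> m\<^sub>1 + m\<^sub>0 \<otimes> m\<^sub>1 \<otimes> e + m \<otimes> e \<otimes> e\<close>. The braiding \<open>\<sigma>\<^sub>C\<^sub>,\<^sub>C\<close> sends the first term to the sum
  of the first two, kills the second, and fixes the third.

\<^item> Compatibility (lemma \<open>\<delta>_\<rho>\<close>). Applying the braiding \<open>\<sigma>\<^sub>C\<^sub>,\<^sub>A\<close> to \<open>\<delta>(m) \<otimes> g\<close> and then acting gives
  \<open>(m\<^sub>0 * g) \<otimes> m\<^sub>1 + m\<^sub>0 \<otimes> (m\<^sub>1 \<sqdot> g) + (m * g) \<otimes> e\<close>. The first two terms are the diagonal action of \<open>g\<close> on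
  \<open>\<delta>\<^sub>0(m)\<close>, so equivariance of \<open>\<delta>\<^sub>0\<close> turns the sum into \<open>\<delta>(m * g)\<close>.

The map \<open>\<iota>\<close> is injective because the projection \<open>K\<^sup>+ \<rightarrow> K\<close> splits the inclusion. Hence \<open>\<delta>\<close> determines
\<open>\<delta>\<^sub>0\<close>, just as the action of \<open>G\<^sup>+\<close> determines that of \<open>G\<close>. This gives injectivity on objects
(lemma \<open>rep_to_yd_inj\<close>), and it also shows that a linear map commutes with the original structure maps
exactly when it commutes with the extended ones, so that the two hom-sets are equal
(lemma \<open>rep_hom_eq_yd_hom\<close>).

The rest makes element calculations with tensors legitimate. The tensor product is a quotient of a free
vector space, and the structure maps are described by their values on some elementary tensors. The
universal property (lemma \<open>tensor_universal\<close>) shows that these descriptions define linear maps, and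
identities between linear maps on tensor products are checked on elementary tensors
(lemmas \<open>tensor_linear_eq\<close> and \<open>tensor_left_nested_linear_eq\<close>).\<close>


section \<open>Linear and bilinear maps\<close>

lemma vectorspaceD:
  assumes "vectorspace F V"
  shows "module F V" "field F" "cring F" "abelian_group V"
  using assms by (auto simp: vectorspace_def module_def)

lemma linear_mapI:
  assumes "vectorspace F U" "vectorspace F V"
    and "\<And>x. x \<in> carrier U \<Longrightarrow> f x \<in> carrier V"
    and "\<And>x y. x \<in> carrier U \<Longrightarrow> y \<in> carrier U \<Longrightarrow> f (x \<oplus>\<^bsub>U\<^esub> y) = f x \<oplus>\<^bsub>V\<^esub> f y"
    and "\<And>c x. c \<in> carrier F \<Longrightarrow> x \<in> carrier U \<Longrightarrow> f (c \<odot>\<^bsub>U\<^esub> x) = c \<odot>\<^bsub>V\<^esub> f x"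
  shows "linear_map F U V f"
  using assms by (auto simp: linear_map_def mod_hom_def mod_hom_axioms_def module_hom_def vectorspaceD)

lemma linear_mapD:
  assumes "linear_map F U V f"
  shows linear_dom: "vectorspace F U" and linear_cod: "vectorspace F V"
    and linear_hom: "f \<in> module_hom F U V"
  using assms by (auto simp: linear_map_def mod_hom_def mod_hom_axioms_def)

lemma linear_closed: "linear_map F U V f \<Longrightarrow> x \<in> carrier U \<Longrightarrow> f x \<in> carrier V"
  by (drule linear_hom) (auto simp: module_hom_def)

lemma linear_add:
  "linear_map F U V f \<Longrightarrow> x \<in> carrier U \<Longrightarrow> y \<in> carrier U \<Longrightarrow> f (x \<oplus>\<^bsub>U\<^esub> y) = f x \<oplus>\<^bsub>V\<^esub> f y"
  by (drule linear_hom) (auto simp: module_hom_def)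

lemma linear_smult:
  "linear_map F U V f \<Longrightarrow> c \<in> carrier F \<Longrightarrow> x \<in> carrier U \<Longrightarrow> f (c \<odot>\<^bsub>U\<^esub> x) = c \<odot>\<^bsub>V\<^esub> f x"
  by (drule linear_hom) (auto simp: module_hom_def)

lemma linear_zero: "linear_map F U V f \<Longrightarrow> f \<zero>\<^bsub>U\<^esub> = \<zero>\<^bsub>V\<^esub>"
  by (rule mod_hom.f0_is_0) (auto simp: linear_map_def)

lemma linear_minus:
  "linear_map F U V f \<Longrightarrow> x \<in> carrier U \<Longrightarrow> y \<in> carrier U \<Longrightarrow> f (x \<ominus>\<^bsub>U\<^esub> y) = f x \<ominus>\<^bsub>V\<^esub> f y"
  by (rule mod_hom.f_minus) (auto simp: linear_map_def)

lemma linear_map_cong: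
  assumes f: "linear_map F U V f" and "\<And>x. x \<in> carrier U \<Longrightarrow> g x = f x"
  shows "linear_map F U V g"
proof -
  interpret U: vectorspace F U by (rule linear_dom[OF f])
  show ?thesis
    using assms
    by (intro linear_mapI) (auto simp: linear_dom linear_cod linear_closed linear_add linear_smult)
qed

lemma linear_comp:
  assumes f: "linear_map F U V f" and g: "linear_map F V W g"
  shows "linear_map F U W (\<lambda>x. g (f x))"
  using f g by (intro linear_mapI)
    (auto simp: linear_dom linear_cod linear_closed linear_add linear_smult)

lemma linear_ident:
  assumes "vectorspace F V"
  shows "linear_map F V V (\<lambda>x. x)"
  using assms by (intro linear_mapI) auto

lemma linear_plus:
  assumes f: "linear_map F U V f" and g: "linear_map F U V g"
  shows "linear_map F U V (\<lambda>x. f x \<oplus>\<^bsub>V\<^esub> g x)"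
proof -
  interpret V: vectorspace F V by (rule linear_cod[OF f])
  show ?thesis
    by (rule linear_mapI)
      (simp_all add: linear_dom[OF f] linear_cod[OF f] linear_closed[OF f] linear_closed[OF g]
        linear_add[OF f] linear_add[OF g] linear_smult[OF f] linear_smult[OF g]
        V.smult_r_distr V.a_ac)
qed

lemma linear_scale:
  assumes f: "linear_map F U V f" and c: "c \<in> carrier F"
  shows "linear_map F U V (\<lambda>x. c \<odot>\<^bsub>V\<^esub> f x)"
proof -
  interpret V: vectorspace F V by (rule linear_cod[OF f])
  show ?thesis
    by (rule linear_mapI)
      (use c in \<open>simp_all add: linear_dom[OF f] linear_cod[OF f] linear_closed[OF f]
        linear_add[OF f] linear_smult[OF f] V.smult_r_distr V.smult_assoc1[symmetric] V.m_comm\<close>)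
qed

lemma linear_const_zero:
  assumes "vectorspace F U" "vectorspace F V"
  shows "linear_map F U V (\<lambda>x. \<zero>\<^bsub>V\<^esub>)"
proof -
  interpret V: vectorspace F V by fact
  show ?thesis using assms by (intro linear_mapI) auto
qed

lemma bilinear_mapI:
  assumes "\<And>u v. u \<in> carrier U \<Longrightarrow> v \<in> carrier V \<Longrightarrow> \<beta> u v \<in> carrier W"
    and "\<And>u u' v. u \<in> carrier U \<Longrightarrow> u' \<in> carrier U \<Longrightarrow> v \<in> carrier V
      \<Longrightarrow> \<beta> (u \<oplus>\<^bsub>U\<^esub> u') v = \<beta> u v \<oplus>\<^bsub>W\<^esub> \<beta> u' v"
    and "\<And>u v v'. u \<in> carrier U \<Longrightarrow> v \<in> carrier V \<Longrightarrow> v' \<in> carrier V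
      \<Longrightarrow> \<beta> u (v \<oplus>\<^bsub>V\<^esub> v') = \<beta> u v \<oplus>\<^bsub>W\<^esub> \<beta> u v'"
    and "\<And>c u v. c \<in> carrier F \<Longrightarrow> u \<in> carrier U \<Longrightarrow> v \<in> carrier V
      \<Longrightarrow> \<beta> (c \<odot>\<^bsub>U\<^esub> u) v = c \<odot>\<^bsub>W\<^esub> \<beta> u v"
    and "\<And>c u v. c \<in> carrier F \<Longrightarrow> u \<in> carrier U \<Longrightarrow> v \<in> carrier V
      \<Longrightarrow> \<beta> u (c \<odot>\<^bsub>V\<^esub> v) = c \<odot>\<^bsub>W\<^esub> \<beta> u v"
  shows "bilinear_map F U V W \<beta>"
  using assms by (auto simp: bilinear_map_def module_hom_def)

lemma bilinear_mapD:
  assumes "bilinear_map F U V W \<beta>"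
  shows bilinear_closed: "\<And>u v. u \<in> carrier U \<Longrightarrow> v \<in> carrier V \<Longrightarrow> \<beta> u v \<in> carrier W"
    and bilinear_add_left: "\<And>u u' v. u \<in> carrier U \<Longrightarrow> u' \<in> carrier U \<Longrightarrow> v \<in> carrier V
      \<Longrightarrow> \<beta> (u \<oplus>\<^bsub>U\<^esub> u') v = \<beta> u v \<oplus>\<^bsub>W\<^esub> \<beta> u' v"
    and bilinear_add_right: "\<And>u v v'. u \<in> carrier U \<Longrightarrow> v \<in> carrier V \<Longrightarrow> v' \<in> carrier V
      \<Longrightarrow> \<beta> u (v \<oplus>\<^bsub>V\<^esub> v') = \<beta> u v \<oplus>\<^bsub>W\<^esub> \<beta> u v'"
    and bilinear_smult_left: "\<And>c u v. c \<in> carrier F \<Longrightarrow> u \<in> carrier U \<Longrightarrow> v \<in> carrier V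
      \<Longrightarrow> \<beta> (c \<odot>\<^bsub>U\<^esub> u) v = c \<odot>\<^bsub>W\<^esub> \<beta> u v"
    and bilinear_smult_right: "\<And>c u v. c \<in> carrier F \<Longrightarrow> u \<in> carrier U \<Longrightarrow> v \<in> carrier V
      \<Longrightarrow> \<beta> u (c \<odot>\<^bsub>V\<^esub> v) = c \<odot>\<^bsub>W\<^esub> \<beta> u v"
  using assms by (auto simp: bilinear_map_def module_hom_def)

lemma bilinear_linear_left:
  assumes "bilinear_map F U V W \<beta>" "vectorspace F U" "vectorspace F W" "v \<in> carrier V"
  shows "linear_map F U W (\<lambda>u. \<beta> u v)"
  using assms by (intro linear_mapI) (auto dest: bilinear_mapD)

lemma bilinear_linear_right:
  assumes "bilinear_map F U V W \<beta>" "vectorspace F V" "vectorspace F W" "u \<in> carrier U"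
  shows "linear_map F V W (\<beta> u)"
  using assms by (intro linear_mapI) (auto dest: bilinear_mapD)

lemma bilinear_precomp:
  assumes \<beta>: "bilinear_map F U' V' W \<beta>" and f: "linear_map F U U' f" and g: "linear_map F V V' g"
  shows "bilinear_map F U V W (\<lambda>u v. \<beta> (f u) (g v))"
  by (rule bilinear_mapI)
    (simp_all add: linear_closed[OF f] linear_closed[OF g] linear_add[OF f] linear_add[OF g]
      linear_smult[OF f] linear_smult[OF g] bilinear_mapD[OF \<beta>])

text \<open>Two linear maps that agree on the carrier become equal once they are restricted to it, so a unique
description with one known solution \<open>h\<close> pins down \<open>the_linear\<close>.\<close>

lemma the_linear_eq_restrict:
  assumes h: "linear_map F U V h" and P: "P (restrict h (carrier U))"
    and unique: "\<And>h' x. linear_map F U V h' \<Longrightarrow> P h' \<Longrightarrow> x \<in> carrier U \<Longrightarrow> h' x = h x"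
  shows "the_linear F U V P = restrict h (carrier U)"
  unfolding the_linear_def
proof (rule the_equality)
  show "restrict h (carrier U) \<in> extensional (carrier U) \<and> linear_map F U V (restrict h (carrier U))
      \<and> P (restrict h (carrier U))"
    using P by (auto intro: linear_map_cong[OF h])
next
  fix h' assume "h' \<in> extensional (carrier U) \<and> linear_map F U V h' \<and> P h'"
  then show "h' = restrict h (carrier U)"
    by (intro extensionalityI[of _ "carrier U"]) (auto simp: unique)
qed


section \<open>Free vector spaces\<close>

lemma free_module_simps:
  "carrier (free_module F S) = {f \<in> S \<rightarrow>\<^sub>E carrier F. finite {s \<in> S. f s \<noteq> \<zero>\<^bsub>F\<^esub>}}"
  "\<zero>\<^bsub>free_module F S\<^esub> = (\<lambda>s\<in>S. \<zero>\<^bsub>F\<^esub>)"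
  "f \<oplus>\<^bsub>free_module F S\<^esub> g = (\<lambda>s\<in>S. f s \<oplus>\<^bsub>F\<^esub> g s)"
  "c \<odot>\<^bsub>free_module F S\<^esub> f = (\<lambda>s\<in>S. c \<otimes>\<^bsub>F\<^esub> f s)"
  if "ring F"
  by (simp_all add: free_module_def ring.func_space_def[OF that])

lemma free_module_vectorspace:
  assumes "field F"
  shows "vectorspace F (free_module F S)"
proof -
  interpret field F by fact
  interpret FS: module F "func_space S" by (rule func_space_is_module)
  have "submodule F {f \<in> S \<rightarrow>\<^sub>E carrier F. finite {s \<in> S. f s \<noteq> \<zero>\<^bsub>F\<^esub>}} (func_space S)"
  proof (unfold_locales, goal_cases)
    case 1 then show ?case by (auto simp: func_space_def)
  next
    case (2 f g)
    have "{s \<in> S. f s \<oplus>\<^bsub>F\<^esub> g s \<noteq> \<zero>\<^bsub>F\<^esub>} \<subseteq> {s \<in> S. f s \<noteq> \<zero>\<^bsub>F\<^esub>} \<union> {s \<in> S. g s \<noteq> \<zero>\<^bsub>F\<^esub>}"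
      by auto
    with 2 have "finite {s \<in> S. f s \<oplus>\<^bsub>F\<^esub> g s \<noteq> \<zero>\<^bsub>F\<^esub>}"
      by (auto intro: finite_subset)
    with 2 show ?case by (auto simp: func_space_def PiE_mem cong: conj_cong)
  next
    case 3 then show ?case by (auto simp: func_space_def cong: conj_cong)
  next
    case (4 c f)
    then have "finite {s \<in> S. c \<otimes>\<^bsub>F\<^esub> f s \<noteq> \<zero>\<^bsub>F\<^esub>}"
      by (auto elim!: rev_finite_subset)
    with 4 show ?case by (auto simp: func_space_def PiE_mem cong: conj_cong)
  qed
  from FS.submodule_is_module[OF this] show ?thesis
    unfolding free_module_def by (intro vectorspace.intro) (auto intro: field_axioms)
qed

lemma free_gen_closed:
  assumes "field F" "s \<in> S"
  shows "free_gen F S s \<in> carrier (free_module F S)"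
proof -
  interpret field F by fact
  have "{t \<in> S. free_gen F S s t \<noteq> \<zero>\<^bsub>F\<^esub>} \<subseteq> {s}"
    by (auto simp: free_gen_def)
  then have "finite {t \<in> S. free_gen F S s t \<noteq> \<zero>\<^bsub>F\<^esub>}"
    by (rule finite_subset) simp
  then show ?thesis
    by (auto simp: free_module_simps[OF ring_axioms] free_gen_def)
qed

text \<open>An element is peeled apart one coefficient at a time, by induction on a finite set that contains its support.\<close>

lemma free_module_induct:
  assumes "field F" and f: "f \<in> carrier (free_module F S)"
    and zero: "P \<zero>\<^bsub>free_module F S\<^esub>"
    and gen: "\<And>c s. c \<in> carrier F \<Longrightarrow> s \<in> S \<Longrightarrow> P (c \<odot>\<^bsub>free_module F S\<^esub> free_gen F S s)"
    and add: "\<And>f g. f \<in> carrier (free_module F S) \<Longrightarrow> g \<in> carrier (free_module F S) \<Longrightarrow> P f \<Longrightarrow> P g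
      \<Longrightarrow> P (f \<oplus>\<^bsub>free_module F S\<^esub> g)"
  shows "P f"
proof -
  interpret field F by fact
  interpret L: vectorspace F "free_module F S" by (rule free_module_vectorspace) fact
  note simps = free_module_simps[OF ring_axioms]
  have "\<forall>f \<in> carrier (free_module F S). {s \<in> S. f s \<noteq> \<zero>\<^bsub>F\<^esub>} \<subseteq> A \<longrightarrow> P f" if "finite A" for A
    using that
  proof (induction A)
    case empty
    have "f = \<zero>\<^bsub>free_module F S\<^esub>"
      if "f \<in> carrier (free_module F S)" "{s \<in> S. f s \<noteq> \<zero>\<^bsub>F\<^esub>} \<subseteq> {}" for f
      using that by (intro extensionalityI[of _ S]) (auto simp: simps PiE_iff)
    then show ?case using zero by blast
  next
    case (insert s A)
    show ?case
    proof (intro ballI impI)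
      fix f assume f: "f \<in> carrier (free_module F S)" and A: "{t \<in> S. f t \<noteq> \<zero>\<^bsub>F\<^esub>} \<subseteq> insert s A"
      let ?r = "\<lambda>t\<in>S. if t = s then \<zero>\<^bsub>F\<^esub> else f t"
      have sub: "{t \<in> S. ?r t \<noteq> \<zero>\<^bsub>F\<^esub>} \<subseteq> {t \<in> S. f t \<noteq> \<zero>\<^bsub>F\<^esub>} - {s}" by auto
      have r: "?r \<in> carrier (free_module F S)"
        using f finite_subset[OF sub] by (auto simp: simps)
      have "{t \<in> S. ?r t \<noteq> \<zero>\<^bsub>F\<^esub>} \<subseteq> A" using sub A by blast
      with insert.IH r have Pr: "P ?r" by blast
      show "P f"
      proof (cases "s \<in> S")
        case True
        then have fs: "f s \<in> carrier F" using f by (auto simp: simps)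
        have "f = f s \<odot>\<^bsub>free_module F S\<^esub> free_gen F S s \<oplus>\<^bsub>free_module F S\<^esub> ?r"
          using f True by (intro extensionalityI[of _ S]) (auto simp: simps free_gen_def PiE_iff)
        moreover have "P (f s \<odot>\<^bsub>free_module F S\<^esub> free_gen F S s \<oplus>\<^bsub>free_module F S\<^esub> ?r)"
          using True fs r Pr gen free_gen_closed[OF \<open>field F\<close> True]
          by (intro add) auto
        ultimately show ?thesis by simp
      next
        case False
        then have "f = ?r"
          using f by (intro extensionalityI[of _ S]) (auto simp: simps PiE_iff)
        with Pr show ?thesis by simp
      qed
    qed
  qed
  then show ?thesis using f by (auto simp: simps)
qed

text \<open>The extension sends \<open>f\<close> to the sum of \<open>f s \<odot> \<beta> s\<close> over the support of \<open>f\<close>. The support depends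
on \<open>f\<close>, so additivity is proved by summing over a common finite set that contains all supports involved.\<close>

lemma free_module_lift:
  assumes "vectorspace F W" and \<beta>: "\<And>s. s \<in> S \<Longrightarrow> \<beta> s \<in> carrier W"
  shows "\<exists>h. linear_map F (free_module F S) W h \<and> (\<forall>s\<in>S. h (free_gen F S s) = \<beta> s)"
proof -
  interpret W: vectorspace F W by fact
  note fld = W.field_axioms
  interpret L: vectorspace F "free_module F S" by (rule free_module_vectorspace[OF fld])
  note simps = free_module_simps[OF W.ring_axioms]
  \<comment> \<open>A sum over the support, which varies with \<open>f\<close>; \<open>h_eq\<close> replaces it by any larger finite set.\<close>
  define h where "h f = (\<Oplus>\<^bsub>W\<^esub>s\<in>{s \<in> S. f s \<noteq> \<zero>\<^bsub>F\<^esub>}. f s \<odot>\<^bsub>W\<^esub> \<beta> s)" for f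
  have h_eq: "h f = (\<Oplus>\<^bsub>W\<^esub>s\<in>A. f s \<odot>\<^bsub>W\<^esub> \<beta> s)"
    if "finite A" "A \<subseteq> S" "{s \<in> S. f s \<noteq> \<zero>\<^bsub>F\<^esub>} \<subseteq> A" "f \<in> S \<rightarrow> carrier F" for f A
    unfolding h_def using that \<beta>
    by (intro W.add.finprod_mono_neutral_cong_left) (auto intro!: W.lmult_0 W.smult_closed)
  have mem: "f \<in> S \<rightarrow> carrier F" if "f \<in> carrier (free_module F S)" for f
    using that by (auto simp: simps)
  have "linear_map F (free_module F S) W h"
  proof (rule linear_mapI)
    fix f assume f: "f \<in> carrier (free_module F S)"
    then show "h f \<in> carrier W"
      unfolding h_def using \<beta> by (auto intro!: W.finsum_closed simp: simps)
    fix g assume g: "g \<in> carrier (free_module F S)"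
    let ?A = "{s \<in> S. f s \<noteq> \<zero>\<^bsub>F\<^esub>} \<union> {s \<in> S. g s \<noteq> \<zero>\<^bsub>F\<^esub>}"
    have fin: "finite ?A" using f g by (simp add: simps)
    have "h (f \<oplus>\<^bsub>free_module F S\<^esub> g)
      = (\<Oplus>\<^bsub>W\<^esub>s\<in>?A. (f \<oplus>\<^bsub>free_module F S\<^esub> g) s \<odot>\<^bsub>W\<^esub> \<beta> s)"
      using fin mem[OF L.a_closed[OF f g]]
      by (intro h_eq) (auto simp: simps)
    also have "\<dots> = (\<Oplus>\<^bsub>W\<^esub>s\<in>?A. f s \<odot>\<^bsub>W\<^esub> \<beta> s \<oplus>\<^bsub>W\<^esub> g s \<odot>\<^bsub>W\<^esub> \<beta> s)"
      using mem[OF f] mem[OF g] \<beta>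
      by (intro W.finsum_cong') (auto simp: simps W.smult_l_distr Pi_iff)
    also have "\<dots> = (\<Oplus>\<^bsub>W\<^esub>s\<in>?A. f s \<odot>\<^bsub>W\<^esub> \<beta> s) \<oplus>\<^bsub>W\<^esub> (\<Oplus>\<^bsub>W\<^esub>s\<in>?A. g s \<odot>\<^bsub>W\<^esub> \<beta> s)"
      using mem[OF f] mem[OF g] \<beta> by (intro W.finsum_addf) (auto simp: Pi_iff)
    also have "\<dots> = h f \<oplus>\<^bsub>W\<^esub> h g"
      using fin mem[OF f] mem[OF g] by (subst (1 2) h_eq[of ?A]) auto
    finally show "h (f \<oplus>\<^bsub>free_module F S\<^esub> g) = h f \<oplus>\<^bsub>W\<^esub> h g" .
  next
    fix c f assume c: "c \<in> carrier F" and f: "f \<in> carrier (free_module F S)"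
    let ?A = "{s \<in> S. f s \<noteq> \<zero>\<^bsub>F\<^esub>}"
    have fin: "finite ?A" using f by (simp add: simps)
    have "h (c \<odot>\<^bsub>free_module F S\<^esub> f) = (\<Oplus>\<^bsub>W\<^esub>s\<in>?A. (c \<odot>\<^bsub>free_module F S\<^esub> f) s \<odot>\<^bsub>W\<^esub> \<beta> s)"
      using fin c mem[OF L.smult_closed[OF c f]] by (intro h_eq) (auto simp: simps)
    also have "\<dots> = (\<Oplus>\<^bsub>W\<^esub>s\<in>?A. c \<odot>\<^bsub>W\<^esub> (f s \<odot>\<^bsub>W\<^esub> \<beta> s))"
      using c mem[OF f] \<beta> by (intro W.finsum_cong') (auto simp: simps W.smult_assoc1 Pi_iff)
    also have "\<dots> = c \<odot>\<^bsub>W\<^esub> h f"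
      unfolding h_def using fin c mem[OF f] \<beta>
      by (intro W.finsum_smult_ldistr[symmetric]) (auto simp: Pi_iff)
    finally show "h (c \<odot>\<^bsub>free_module F S\<^esub> f) = c \<odot>\<^bsub>W\<^esub> h f" .
  qed (unfold_locales)
  moreover have "h (free_gen F S s) = \<beta> s" if s: "s \<in> S" for s
  proof -
    have "h (free_gen F S s) = (\<Oplus>\<^bsub>W\<^esub>t\<in>{s}. free_gen F S s t \<odot>\<^bsub>W\<^esub> \<beta> t)"
      using s by (intro h_eq) (auto simp: free_gen_def)
    also have "\<dots> = \<beta> s" using s \<beta> by (simp add: free_gen_def)
    finally show ?thesis .
  qed
  ultimately show ?thesis by blast
qed


section \<open>Quotient spaces\<close>

lemma quotient_module_simps:
  "carrier (quotient_module V N) = (\<lambda>x. N +>\<^bsub>V\<^esub> x) ` carrier V"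
  "\<zero>\<^bsub>quotient_module V N\<^esub> = N"
  "X \<oplus>\<^bsub>quotient_module V N\<^esub> Y = X <+>\<^bsub>V\<^esub> Y"
  "c \<odot>\<^bsub>quotient_module V N\<^esub> X = (\<Union>x\<in>X. N +>\<^bsub>V\<^esub> (c \<odot>\<^bsub>V\<^esub> x))"
  by (auto simp: quotient_module_def A_RCOSETS_def')

lemma submodule_abelian_subgroup:
  assumes "submodule F N V"
  shows "abelian_subgroup N V"
proof -
  interpret submodule F N V by fact
  interpret V: module F V by (rule module)
  have inv: "\<ominus>\<^bsub>V\<^esub> x \<in> N" if "x \<in> N" for x
  proof -
    have "x \<in> carrier V" using that subset by blast
    then show ?thesis using smult_closed[of "\<ominus>\<^bsub>F\<^esub> \<one>\<^bsub>F\<^esub>" x] that by (simp add: V.smult_minus_1)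
  qed
  have "subgroup N (add_monoid V)"
    using subset inv by (intro V.add.subgroupI) (auto intro: zero_closed)
  then show ?thesis
    by (rule abelian_subgroupI3[OF additive_subgroupI V.abelian_group_axioms])
qed

text \<open>In the quotient, the multiple \<open>c \<odot> X\<close> is a union of cosets, one for each element of \<open>X\<close>; it is a single coset
because these all coincide.\<close>

lemma quotient_ops:
  assumes "submodule F N V"
  shows quotient_add: "x \<in> carrier V \<Longrightarrow> y \<in> carrier V \<Longrightarrow>
      (N +>\<^bsub>V\<^esub> x) \<oplus>\<^bsub>quotient_module V N\<^esub> (N +>\<^bsub>V\<^esub> y) = N +>\<^bsub>V\<^esub> (x \<oplus>\<^bsub>V\<^esub> y)"
    and quotient_smult: "c \<in> carrier F \<Longrightarrow> x \<in> carrier V \<Longrightarrow>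
      c \<odot>\<^bsub>quotient_module V N\<^esub> (N +>\<^bsub>V\<^esub> x) = N +>\<^bsub>V\<^esub> (c \<odot>\<^bsub>V\<^esub> x)"
    and quotient_eq_iff: "x \<in> carrier V \<Longrightarrow> y \<in> carrier V \<Longrightarrow>
      N +>\<^bsub>V\<^esub> x = N +>\<^bsub>V\<^esub> y \<longleftrightarrow> x \<ominus>\<^bsub>V\<^esub> y \<in> N"
proof -
  interpret submodule F N V by fact
  interpret V: module F V by (rule module)
  interpret N: abelian_subgroup N V by (rule submodule_abelian_subgroup) fact
  show eq_iff: "N +>\<^bsub>V\<^esub> x = N +>\<^bsub>V\<^esub> y \<longleftrightarrow> x \<ominus>\<^bsub>V\<^esub> y \<in> N"
    if "x \<in> carrier V" "y \<in> carrier V" for x y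
  proof -
    have "x \<ominus>\<^bsub>V\<^esub> y \<in> N \<longleftrightarrow> x \<in> N +>\<^bsub>V\<^esub> y"
      using that N.a_rcos_module[of y x]
      by (simp add: a_minus_def)
    also have "\<dots> \<longleftrightarrow> N +>\<^bsub>V\<^esub> x = N +>\<^bsub>V\<^esub> y"
      using that N.a_repr_independence'[of x y] N.a_rcos_self[of x] by auto
    finally show ?thesis by simp
  qed
  show "(N +>\<^bsub>V\<^esub> x) \<oplus>\<^bsub>quotient_module V N\<^esub> (N +>\<^bsub>V\<^esub> y) = N +>\<^bsub>V\<^esub> (x \<oplus>\<^bsub>V\<^esub> y)"
    if "x \<in> carrier V" "y \<in> carrier V"
    using that by (simp add: quotient_module_simps N.a_rcos_sum)
  show "c \<odot>\<^bsub>quotient_module V N\<^esub> (N +>\<^bsub>V\<^esub> x) = N +>\<^bsub>V\<^esub> (c \<odot>\<^bsub>V\<^esub> x)"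
    if cx: "c \<in> carrier F" "x \<in> carrier V"
  proof -
    have const: "N +>\<^bsub>V\<^esub> (c \<odot>\<^bsub>V\<^esub> y) = N +>\<^bsub>V\<^esub> (c \<odot>\<^bsub>V\<^esub> x)" if y: "y \<in> N +>\<^bsub>V\<^esub> x" for y
    proof -
      obtain n where n: "n \<in> N" "y = n \<oplus>\<^bsub>V\<^esub> x" using y by (auto simp: a_r_coset_def')
      then have nV: "n \<in> carrier V" using subset by blast
      have "c \<odot>\<^bsub>V\<^esub> y \<ominus>\<^bsub>V\<^esub> c \<odot>\<^bsub>V\<^esub> x = c \<odot>\<^bsub>V\<^esub> n"
        using n nV cx by (simp add: V.smult_r_distr a_minus_def V.a_assoc V.r_neg)
      moreover have "c \<odot>\<^bsub>V\<^esub> n \<in> N" using n cx by simp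
      ultimately show ?thesis
        using n nV cx by (subst eq_iff) simp_all
    qed
    have "x \<in> N +>\<^bsub>V\<^esub> x" using cx by (intro N.a_rcos_self)
    then show ?thesis unfolding quotient_module_simps by (intro SUP_eq_const const) blast+
  qed
qed

lemma quotient_vectorspace:
  assumes V: "vectorspace F V" and N: "submodule F N V"
  shows "vectorspace F (quotient_module V N)"
proof -
  interpret V: vectorspace F V by fact
  interpret N: abelian_subgroup N V by (rule submodule_abelian_subgroup) fact
  note ops = quotient_add[OF N] quotient_smult[OF N]
  have Nz: "\<zero>\<^bsub>quotient_module V N\<^esub> = N +>\<^bsub>V\<^esub> \<zero>\<^bsub>V\<^esub>"
    using N.a_subset by (simp add: quotient_module_simps)
  have "abelian_group (quotient_module V N)"
  proof (rule abelian_groupI)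
    show "\<exists>Y\<in>carrier (quotient_module V N). Y \<oplus>\<^bsub>quotient_module V N\<^esub> X = \<zero>\<^bsub>quotient_module V N\<^esub>"
      if X: "X \<in> carrier (quotient_module V N)" for X
    proof -
      from X obtain x where x: "x \<in> carrier V" "X = N +>\<^bsub>V\<^esub> x" by (auto simp: quotient_module_simps(1))
      show ?thesis
        using x by (intro bexI[of _ "N +>\<^bsub>V\<^esub> (\<ominus>\<^bsub>V\<^esub> x)"])
          (auto simp: ops Nz V.l_neg, simp add: quotient_module_simps(1))
    qed
  qed (unfold Nz, auto simp: quotient_module_simps(1) ops V.a_ac)
  then have "module F (quotient_module V N)"
    by (intro moduleI)
      (auto simp: quotient_module_simps(1) ops V.smult_l_distr V.smult_r_distr V.smult_assoc1
        intro: V.cring_axioms)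
  then show ?thesis by (intro vectorspace.intro V.field_axioms)
qed

lemma quotient_lift:
  assumes h: "linear_map F V W h" and N: "submodule F N V"
    and vanish: "\<And>x. x \<in> N \<Longrightarrow> h x = \<zero>\<^bsub>W\<^esub>"
  shows "\<exists>h'. linear_map F (quotient_module V N) W h' \<and> (\<forall>x\<in>carrier V. h' (N +>\<^bsub>V\<^esub> x) = h x)"
proof -
  interpret V: vectorspace F V by (rule linear_dom[OF h])
  interpret W: vectorspace F W by (rule linear_cod[OF h])
  define h' where "h' X = h (SOME x. x \<in> carrier V \<and> X = N +>\<^bsub>V\<^esub> x)" for X
  have h': "h' (N +>\<^bsub>V\<^esub> x) = h x" if x: "x \<in> carrier V" for x
  proof -
    define y where "y = (SOME y. y \<in> carrier V \<and> N +>\<^bsub>V\<^esub> x = N +>\<^bsub>V\<^esub> y)"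
    have y: "y \<in> carrier V \<and> N +>\<^bsub>V\<^esub> x = N +>\<^bsub>V\<^esub> y"
      unfolding y_def by (rule someI_ex) (use x in blast)
    then have "x \<ominus>\<^bsub>V\<^esub> y \<in> N" using x quotient_eq_iff[OF N, of x y] by simp
    then have "h x \<ominus>\<^bsub>W\<^esub> h y = \<zero>\<^bsub>W\<^esub>" using vanish linear_minus[OF h, of x y] x y by simp
    then have "h x = h y" using x y by (simp add: linear_closed[OF h])
    then show ?thesis by (simp add: h'_def y_def)
  qed
  have "linear_map F (quotient_module V N) W h'"
    by (rule linear_mapI)
      (auto simp: quotient_module_simps(1) quotient_add[OF N] quotient_smult[OF N] h'
        linear_closed[OF h] linear_add[OF h] linear_smult[OF h]
        quotient_vectorspace[OF linear_dom[OF h] N] linear_cod[OF h])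
  with h' show ?thesis by blast
qed


section \<open>Tensor products\<close>

context
  fixes F :: "('f, 'x) ring_scheme" and U :: "('f, 'u, 'y) module_scheme"
    and V :: "('f, 'v, 'z) module_scheme"
  assumes U: "vectorspace F U" and V: "vectorspace F V"
begin

interpretation U: vectorspace F U by (rule U)
interpretation V: vectorspace F V by (rule V)

private abbreviation (input) "L \<equiv> free_module F (carrier U \<times> carrier V)"
private abbreviation (input) "g u v \<equiv> free_gen F (carrier U \<times> carrier V) (u, v)"

interpretation L: vectorspace F L by (rule free_module_vectorspace[OF U.field_axioms])

lemma gen_closed: "u \<in> carrier U \<Longrightarrow> v \<in> carrier V \<Longrightarrow> g u v \<in> carrier L"
  by (intro free_gen_closed U.field_axioms) simp

lemma tensor_rels_subset: "tensor_rels F U V \<subseteq> carrier L"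
  unfolding tensor_rels_def Let_def
  by (auto intro!: L.minus_closed L.a_closed L.smult_closed gen_closed U.smult_closed V.smult_closed)

lemma tensor_null_submodule: "submodule F (tensor_null F U V) L"
  unfolding tensor_null_def by (rule L.span_is_submodule[OF tensor_rels_subset])

lemma tensor_rels_null: "r \<in> tensor_rels F U V \<Longrightarrow> r \<in> tensor_null F U V"
  unfolding tensor_null_def using L.in_own_span[OF tensor_rels_subset] by blast

lemma tensor_vectorspace: "vectorspace F (tensor F U V)"
  unfolding tensor_def by (rule quotient_vectorspace[OF L.vectorspace_axioms tensor_null_submodule])

lemma pure_bilinear: "bilinear_map F U V (tensor F U V) (pure F U V)"
proof -
  note N = tensor_null_submodule
  note simps = pure_def tensor_def quotient_add[OF N] quotient_smult[OF N] quotient_eq_iff[OF N] gen_closed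
  show ?thesis
  proof (rule bilinear_mapI)
    fix u v assume uv: "u \<in> carrier U" "v \<in> carrier V"
    then show "pure F U V u v \<in> carrier (tensor F U V)"
      by (auto simp: pure_def tensor_def quotient_module_simps(1) intro!: imageI gen_closed)
    show "pure F U V (u \<oplus>\<^bsub>U\<^esub> u') v = pure F U V u v \<oplus>\<^bsub>tensor F U V\<^esub> pure F U V u' v"
      if u': "u' \<in> carrier U" for u'
    proof -
      have "g (u \<oplus>\<^bsub>U\<^esub> u') v \<ominus>\<^bsub>L\<^esub> (g u v \<oplus>\<^bsub>L\<^esub> g u' v) \<in> tensor_rels F U V"
        unfolding tensor_rels_def Let_def using uv u' by blast
      from tensor_rels_null[OF this] show ?thesis using uv u' by (simp add: simps)
    qed
    show "pure F U V u (v \<oplus>\<^bsub>V\<^esub> v') = pure F U V u v \<oplus>\<^bsub>tensor F U V\<^esub> pure F U V u v'"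
      if v': "v' \<in> carrier V" for v'
    proof -
      have "g u (v \<oplus>\<^bsub>V\<^esub> v') \<ominus>\<^bsub>L\<^esub> (g u v \<oplus>\<^bsub>L\<^esub> g u v') \<in> tensor_rels F U V"
        unfolding tensor_rels_def Let_def using uv v' by blast
      from tensor_rels_null[OF this] show ?thesis using uv v' by (simp add: simps)
    qed
    fix c assume c: "c \<in> carrier F"
    show "pure F U V (c \<odot>\<^bsub>U\<^esub> u) v = c \<odot>\<^bsub>tensor F U V\<^esub> pure F U V u v"
    proof -
      have "g (c \<odot>\<^bsub>U\<^esub> u) v \<ominus>\<^bsub>L\<^esub> c \<odot>\<^bsub>L\<^esub> g u v \<in> tensor_rels F U V"
        unfolding tensor_rels_def Let_def using uv c by blast
      from tensor_rels_null[OF this] show ?thesis using uv c by (simp add: simps)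
    qed
    show "pure F U V u (c \<odot>\<^bsub>V\<^esub> v) = c \<odot>\<^bsub>tensor F U V\<^esub> pure F U V u v"
    proof -
      have "g u (c \<odot>\<^bsub>V\<^esub> v) \<ominus>\<^bsub>L\<^esub> c \<odot>\<^bsub>L\<^esub> g u v \<in> tensor_rels F U V"
        unfolding tensor_rels_def Let_def using uv c by blast
      from tensor_rels_null[OF this] show ?thesis using uv c by (simp add: simps)
    qed
  qed
qed

lemmas pure_closed = bilinear_closed[OF pure_bilinear]
  and pure_add_left = bilinear_add_left[OF pure_bilinear]
  and pure_smult_left = bilinear_smult_left[OF pure_bilinear]

text \<open>Every tensor is a sum of elementary ones: a scalar coefficient can be moved into the first factor, and
the empty sum is the elementary tensor of two zeros.\<close>

lemma tensor_induct:
  assumes t: "t \<in> carrier (tensor F U V)"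
    and pure: "\<And>u v. u \<in> carrier U \<Longrightarrow> v \<in> carrier V \<Longrightarrow> P (pure F U V u v)"
    and add: "\<And>s t. s \<in> carrier (tensor F U V) \<Longrightarrow> t \<in> carrier (tensor F U V) \<Longrightarrow> P s \<Longrightarrow> P t
      \<Longrightarrow> P (s \<oplus>\<^bsub>tensor F U V\<^esub> t)"
  shows "P t"
proof -
  note N = tensor_null_submodule
  have scaled: "tensor_null F U V +>\<^bsub>L\<^esub> (c \<odot>\<^bsub>L\<^esub> g u v) = pure F U V (c \<odot>\<^bsub>U\<^esub> u) v"
    if "c \<in> carrier F" "u \<in> carrier U" "v \<in> carrier V" for c u v
  proof -
    have "tensor_null F U V +>\<^bsub>L\<^esub> (c \<odot>\<^bsub>L\<^esub> g u v) = c \<odot>\<^bsub>tensor F U V\<^esub> pure F U V u v"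
      unfolding tensor_def pure_def using that by (simp add: quotient_smult[OF N] gen_closed)
    also have "\<dots> = pure F U V (c \<odot>\<^bsub>U\<^esub> u) v" using that by (simp add: pure_smult_left)
    finally show ?thesis .
  qed
  from t obtain f where f: "f \<in> carrier L" "t = tensor_null F U V +>\<^bsub>L\<^esub> f"
    by (auto simp: tensor_def quotient_module_simps(1))
  have "P (tensor_null F U V +>\<^bsub>L\<^esub> f)"
    using U.field_axioms f(1)
  proof (rule free_module_induct)
    \<comment> \<open>The empty combination is written as a scaled generator too.\<close>
    have "\<zero>\<^bsub>L\<^esub> = \<zero>\<^bsub>F\<^esub> \<odot>\<^bsub>L\<^esub> g \<zero>\<^bsub>U\<^esub> \<zero>\<^bsub>V\<^esub>" by (simp add: gen_closed)
    then show "P (tensor_null F U V +>\<^bsub>L\<^esub> \<zero>\<^bsub>L\<^esub>)"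
      using scaled[of "\<zero>\<^bsub>F\<^esub>" "\<zero>\<^bsub>U\<^esub>" "\<zero>\<^bsub>V\<^esub>"] pure by simp
  next
    fix c s assume "c \<in> carrier F" "s \<in> carrier U \<times> carrier V"
    then show "P (tensor_null F U V +>\<^bsub>L\<^esub> (c \<odot>\<^bsub>L\<^esub> free_gen F (carrier U \<times> carrier V) s))"
      using scaled pure by (cases s) auto
  next
    fix f f' assume "f \<in> carrier L" "f' \<in> carrier L"
      and "P (tensor_null F U V +>\<^bsub>L\<^esub> f)" "P (tensor_null F U V +>\<^bsub>L\<^esub> f')"
    then show "P (tensor_null F U V +>\<^bsub>L\<^esub> (f \<oplus>\<^bsub>L\<^esub> f'))"
      using add by (simp add: quotient_add[OF N, symmetric] tensor_def quotient_module_simps(1))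
  qed
  with f show ?thesis by simp
qed

lemma tensor_linear_eq:
  assumes h: "linear_map F (tensor F U V) W h" and h': "linear_map F (tensor F U V) W h'"
    and eq: "\<And>u v. u \<in> carrier U \<Longrightarrow> v \<in> carrier V \<Longrightarrow> h (pure F U V u v) = h' (pure F U V u v)"
    and t: "t \<in> carrier (tensor F U V)"
  shows "h t = h' t"
  using t by (rule tensor_induct) (simp_all add: eq linear_add[OF h] linear_add[OF h'])

text \<open>The bilinear map is extended linearly to the free vector space. Bilinearity says that the defining relations
lie in the kernel of the extension, which therefore contains their span.\<close>

lemma tensor_universal:
  assumes W: "vectorspace F W" and \<beta>: "bilinear_map F U V W \<beta>"
  shows "\<exists>h. linear_map F (tensor F U V) W h \<and>
    (\<forall>u\<in>carrier U. \<forall>v\<in>carrier V. h (pure F U V u v) = \<beta> u v)"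
proof -
  interpret W: vectorspace F W by (rule W)
  obtain h where h: "linear_map F L W h"
    and h_gen: "\<And>u v. u \<in> carrier U \<Longrightarrow> v \<in> carrier V \<Longrightarrow> h (g u v) = \<beta> u v"
    using free_module_lift[OF W, of "carrier U \<times> carrier V" "\<lambda>(u, v). \<beta> u v"]
      bilinear_closed[OF \<beta>] by auto
  interpret h: mod_hom F L W h using h by (simp add: linear_map_def)
  have "tensor_rels F U V \<subseteq> h.ker"
    unfolding tensor_rels_def Let_def h.ker_def
    by (auto intro!: L.minus_closed L.a_closed L.smult_closed gen_closed
        simp: linear_minus[OF h] linear_add[OF h] linear_smult[OF h] gen_closed h_gen
          bilinear_mapD[OF \<beta>])
  then have "tensor_null F U V \<subseteq> h.ker"
    unfolding tensor_null_def by (rule L.span_is_subset[OF _ h.ker_is_submodule])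
  then have "\<And>x. x \<in> tensor_null F U V \<Longrightarrow> h x = \<zero>\<^bsub>W\<^esub>" by (auto simp: h.ker_def)
  from quotient_lift[OF h tensor_null_submodule this]
  obtain h' where "linear_map F (tensor F U V) W h'"
    and "\<And>x. x \<in> carrier L \<Longrightarrow> h' (tensor_null F U V +>\<^bsub>L\<^esub> x) = h x"
    unfolding tensor_def by blast
  then show ?thesis
    by (intro exI[of _ h']) (auto simp: pure_def gen_closed h_gen)
qed

text \<open>The braidings, the associators and the extended action are each described by a property \<open>P\<close> that prescribes values
on special tensors only. If \<open>P\<close> is equivalent, for linear maps, to taking the values of a bilinear map \<open>\<beta>\<close>
on elementary tensors, then the description determines a linear map with these values.\<close>

lemma tensor_the_linear:
  assumes W: "vectorspace F W" and \<beta>: "bilinear_map F U V W \<beta>"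
    and P: "\<And>h. (\<And>u v. u \<in> carrier U \<Longrightarrow> v \<in> carrier V \<Longrightarrow> h (pure F U V u v) = \<beta> u v) \<Longrightarrow> P h"
    and unique: "\<And>h u v. linear_map F (tensor F U V) W h \<Longrightarrow> P h \<Longrightarrow> u \<in> carrier U \<Longrightarrow> v \<in> carrier V
      \<Longrightarrow> h (pure F U V u v) = \<beta> u v"
  shows "the_linear F (tensor F U V) W P \<in> extensional (carrier (tensor F U V))"
    and "linear_map F (tensor F U V) W (the_linear F (tensor F U V) W P)"
    and "u \<in> carrier U \<Longrightarrow> v \<in> carrier V \<Longrightarrow> the_linear F (tensor F U V) W P (pure F U V u v) = \<beta> u v"
proof -
  obtain h where h: "linear_map F (tensor F U V) W h"
    and h_pure: "\<And>u v. u \<in> carrier U \<Longrightarrow> v \<in> carrier V \<Longrightarrow> h (pure F U V u v) = \<beta> u v"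
    using tensor_universal[OF W \<beta>] by blast
  have eq: "the_linear F (tensor F U V) W P = restrict h (carrier (tensor F U V))"
  proof (rule the_linear_eq_restrict[OF h])
    show "P (restrict h (carrier (tensor F U V)))"
      by (rule P) (simp add: pure_closed h_pure)
  next
    fix h' x assume h': "linear_map F (tensor F U V) W h'" "P h'" and x: "x \<in> carrier (tensor F U V)"
    show "h' x = h x"
      by (rule tensor_linear_eq[OF h'(1) h _ x]) (simp add: unique[OF h'] h_pure)
  qed
  show "the_linear F (tensor F U V) W P \<in> extensional (carrier (tensor F U V))"
    unfolding eq by simp
  show "linear_map F (tensor F U V) W (the_linear F (tensor F U V) W P)"
    unfolding eq by (rule linear_map_cong[OF h]) simp
  show "the_linear F (tensor F U V) W P (pure F U V u v) = \<beta> u v"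
    if "u \<in> carrier U" "v \<in> carrier V"
    unfolding eq using that by (simp add: pure_closed h_pure)
qed

end

definition tensor_lift :: "('f, 'x) ring_scheme \<Rightarrow> ('f, 'u, 'y) module_scheme
    \<Rightarrow> ('f, 'v, 'z) module_scheme \<Rightarrow> ('f, 'w, 't) module_scheme
    \<Rightarrow> ('u \<Rightarrow> 'v \<Rightarrow> 'w) \<Rightarrow> ('u \<times> 'v \<Rightarrow> 'f) set \<Rightarrow> 'w" where
  "tensor_lift F U V W \<beta> = the_linear F (tensor F U V) W
     (\<lambda>h. \<forall>u\<in>carrier U. \<forall>v\<in>carrier V. h (pure F U V u v) = \<beta> u v)"

lemma tensor_lift:
  assumes U: "vectorspace F U" and V: "vectorspace F V" and W: "vectorspace F W"
    and \<beta>: "bilinear_map F U V W \<beta>"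
  shows tensor_lift_linear: "linear_map F (tensor F U V) W (tensor_lift F U V W \<beta>)"
    and tensor_lift_pure: "u \<in> carrier U \<Longrightarrow> v \<in> carrier V
      \<Longrightarrow> tensor_lift F U V W \<beta> (pure F U V u v) = \<beta> u v"
  unfolding tensor_lift_def
  by (rule tensor_the_linear[OF U V W \<beta>]; simp)+

lemma bilinear_plus:
  assumes W: "vectorspace F W" and \<beta>: "bilinear_map F U V W \<beta>" and \<gamma>: "bilinear_map F U V W \<gamma>"
  shows "bilinear_map F U V W (\<lambda>u v. \<beta> u v \<oplus>\<^bsub>W\<^esub> \<gamma> u v)"
proof -
  interpret W: vectorspace F W by (rule W)
  show ?thesis
    by (rule bilinear_mapI)
      (simp_all add: bilinear_mapD[OF \<beta>] bilinear_mapD[OF \<gamma>] W.smult_r_distr W.a_ac)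
qed

lemma bilinear_swap: "bilinear_map F U V W \<beta> \<Longrightarrow> bilinear_map F V U W (\<lambda>v u. \<beta> u v)"
  by (auto simp: bilinear_map_def)

lemma bilinear_postcomp:
  assumes \<beta>: "bilinear_map F U V W \<beta>" and f: "linear_map F W W' f"
  shows "bilinear_map F U V W' (\<lambda>u v. f (\<beta> u v))"
  by (rule bilinear_mapI)
    (simp_all add: bilinear_mapD[OF \<beta>] linear_closed[OF f] linear_add[OF f] linear_smult[OF f])

lemma pure_linear_left:
  assumes "vectorspace F U" "vectorspace F V" "v \<in> carrier V"
  shows "linear_map F U (tensor F U V) (\<lambda>u. pure F U V u v)"
  by (rule bilinear_linear_left[OF pure_bilinear[OF assms(1,2)] assms(1) tensor_vectorspace[OF assms(1,2)] assms(3)])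

lemma pure_linear_right:
  assumes "vectorspace F U" "vectorspace F V" "u \<in> carrier U"
  shows "linear_map F V (tensor F U V) (pure F U V u)"
  by (rule bilinear_linear_right[OF pure_bilinear[OF assms(1,2)] assms(2) tensor_vectorspace[OF assms(1,2)] assms(3)])

lemma tensor_map:
  assumes f: "linear_map F U U' f" and g: "linear_map F V V' g"
  shows tensor_map_linear: "linear_map F (tensor F U V) (tensor F U' V') (tensor_map F U V U' V' f g)"
    and tensor_map_pure: "u \<in> carrier U \<Longrightarrow> v \<in> carrier V
      \<Longrightarrow> tensor_map F U V U' V' f g (pure F U V u v) = pure F U' V' (f u) (g v)"
proof -
  have eq: "tensor_map F U V U' V' f g =
      tensor_lift F U V (tensor F U' V') (\<lambda>u v. pure F U' V' (f u) (g v))"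
    by (simp add: tensor_map_def tensor_lift_def)
  have bil: "bilinear_map F U V (tensor F U' V') (\<lambda>u v. pure F U' V' (f u) (g v))"
    by (rule bilinear_precomp[OF pure_bilinear f g]) (rule linear_cod[OF f] linear_cod[OF g])+
  note vs = linear_dom[OF f] linear_dom[OF g] tensor_vectorspace[OF linear_cod[OF f] linear_cod[OF g]]
  show "linear_map F (tensor F U V) (tensor F U' V') (tensor_map F U V U' V' f g)"
    unfolding eq by (rule tensor_lift_linear[OF vs bil])
  show "u \<in> carrier U \<Longrightarrow> v \<in> carrier V
      \<Longrightarrow> tensor_map F U V U' V' f g (pure F U V u v) = pure F U' V' (f u) (g v)"
    unfolding eq by (rule tensor_lift_pure[OF vs bil])
qed

lemma tensor_map_comp:
  assumes f: "linear_map F U U' f" and g: "linear_map F V V' g"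
    and f': "linear_map F U' U'' f'" and g': "linear_map F V' V'' g'"
    and t: "t \<in> carrier (tensor F U V)"
  shows "tensor_map F U' V' U'' V'' f' g' (tensor_map F U V U' V' f g t)
    = tensor_map F U V U'' V'' (\<lambda>u. f' (f u)) (\<lambda>v. g' (g v)) t"
  using linear_dom[OF f] linear_dom[OF g]
    linear_comp[OF tensor_map_linear[OF f g] tensor_map_linear[OF f' g']]
    tensor_map_linear[OF linear_comp[OF f f'] linear_comp[OF g g']] _ t
proof (rule tensor_linear_eq)
  fix u v assume "u \<in> carrier U" "v \<in> carrier V"
  then show "tensor_map F U' V' U'' V'' f' g' (tensor_map F U V U' V' f g (pure F U V u v))
    = tensor_map F U V U'' V'' (\<lambda>u. f' (f u)) (\<lambda>v. g' (g v)) (pure F U V u v)"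
    by (simp add: tensor_map_pure[OF f g] tensor_map_pure[OF f' g'] linear_closed[OF f]
        linear_closed[OF g] tensor_map_pure[OF linear_comp[OF f f'] linear_comp[OF g g']])
qed

lemma tensor_map_ident:
  assumes U: "vectorspace F U" and V: "vectorspace F V"
    and f: "\<And>u. u \<in> carrier U \<Longrightarrow> f u = u" and g: "\<And>v. v \<in> carrier V \<Longrightarrow> g v = v"
    and t: "t \<in> carrier (tensor F U V)"
  shows "tensor_map F U V U V f g t = t"
proof -
  have fl: "linear_map F U U f" by (rule linear_map_cong[OF linear_ident[OF U]]) (rule f)
  have gl: "linear_map F V V g" by (rule linear_map_cong[OF linear_ident[OF V]]) (rule g)
  show ?thesis
    using U V tensor_map_linear[OF fl gl] linear_ident[OF tensor_vectorspace[OF U V]] _ t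
    by (rule tensor_linear_eq) (simp add: tensor_map_pure[OF fl gl] f g)
qed


section \<open>Threefold tensor products and associators\<close>

lemma tensor_left_nested_linear_eq:
  assumes U: "vectorspace F U" and V: "vectorspace F V" and W: "vectorspace F W"
    and h: "linear_map F (tensor F (tensor F U V) W) X h"
    and h': "linear_map F (tensor F (tensor F U V) W) X h'"
    and eq: "\<And>u v w. u \<in> carrier U \<Longrightarrow> v \<in> carrier V \<Longrightarrow> w \<in> carrier W \<Longrightarrow>
      h (pure F (tensor F U V) W (pure F U V u v) w) = h' (pure F (tensor F U V) W (pure F U V u v) w)"
    and t: "t \<in> carrier (tensor F (tensor F U V) W)"
  shows "h t = h' t"
proof (rule tensor_linear_eq[OF tensor_vectorspace[OF U V] W h h' _ t])
  fix s w assume s: "s \<in> carrier (tensor F U V)" and w: "w \<in> carrier W"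
  note lin = pure_linear_left[OF tensor_vectorspace[OF U V] W w]
  show "h (pure F (tensor F U V) W s w) = h' (pure F (tensor F U V) W s w)"
    by (rule tensor_linear_eq[OF U V linear_comp[OF lin h] linear_comp[OF lin h'] _ s]) (simp add: eq w)
qed

text \<open>Currying: a trilinear map \<open>\<tau>\<close> gives a bilinear map on \<open>(U \<otimes> V) \<times> W\<close>. This is half of the universal property
of a triple tensor product, and both associators are obtained from it.\<close>

lemma bilinear_tensor_lift:
  assumes U: "vectorspace F U" and V: "vectorspace F V" and W: "vectorspace F W" and X: "vectorspace F X"
    and bil: "\<And>w. w \<in> carrier W \<Longrightarrow> bilinear_map F U V X (\<lambda>u v. \<tau> u v w)"
    and lin: "\<And>u v. u \<in> carrier U \<Longrightarrow> v \<in> carrier V \<Longrightarrow> linear_map F W X (\<tau> u v)"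
  shows "bilinear_map F (tensor F U V) W X (\<lambda>t w. tensor_lift F U V X (\<lambda>u v. \<tau> u v w) t)"
proof -
  interpret W: vectorspace F W by (rule W)
  note lift_lin = tensor_lift_linear[OF U V X bil] and lift_pure = tensor_lift_pure[OF U V X bil]
  show ?thesis
  proof (rule bilinear_mapI)
    fix t w w' assume t: "t \<in> carrier (tensor F U V)" and w: "w \<in> carrier W" "w' \<in> carrier W"
    show "tensor_lift F U V X (\<lambda>u v. \<tau> u v (w \<oplus>\<^bsub>W\<^esub> w')) t =
        tensor_lift F U V X (\<lambda>u v. \<tau> u v w) t \<oplus>\<^bsub>X\<^esub> tensor_lift F U V X (\<lambda>u v. \<tau> u v w') t"
      by (rule tensor_linear_eq[OF U V lift_lin linear_plus[OF lift_lin lift_lin] _ t])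
        (use w in \<open>auto simp: lift_pure linear_add[OF lin]\<close>)
  next
    fix c t w assume c: "c \<in> carrier F" and t: "t \<in> carrier (tensor F U V)" and w: "w \<in> carrier W"
    show "tensor_lift F U V X (\<lambda>u v. \<tau> u v (c \<odot>\<^bsub>W\<^esub> w)) t
        = c \<odot>\<^bsub>X\<^esub> tensor_lift F U V X (\<lambda>u v. \<tau> u v w) t"
      by (rule tensor_linear_eq[OF U V lift_lin linear_scale[OF lift_lin] _ t])
        (use w c in \<open>auto simp: lift_pure linear_smult[OF lin]\<close>)
  qed (auto simp: linear_closed[OF lift_lin] linear_add[OF lift_lin] linear_smult[OF lift_lin])
qed

lemma tensor_assoc:
  assumes U: "vectorspace F U" and V: "vectorspace F V" and W: "vectorspace F W"
  shows tensor_assoc_linear: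
      "linear_map F (tensor F (tensor F U V) W) (tensor F U (tensor F V W)) (tensor_assoc F U V W)"
    and tensor_assoc_pure: "u \<in> carrier U \<Longrightarrow> v \<in> carrier V \<Longrightarrow> w \<in> carrier W \<Longrightarrow>
      tensor_assoc F U V W (pure F (tensor F U V) W (pure F U V u v) w)
        = pure F U (tensor F V W) u (pure F V W v w)"
proof -
  let ?X = "tensor F U (tensor F V W)"
  let ?\<tau> = "\<lambda>u v w. pure F U (tensor F V W) u (pure F V W v w)"
  let ?\<beta> = "\<lambda>t w. tensor_lift F U V ?X (\<lambda>u v. ?\<tau> u v w) t"
  note UV = tensor_vectorspace[OF U V] and VW = tensor_vectorspace[OF V W]
  note X = tensor_vectorspace[OF U VW]
  have bil: "bilinear_map F U V ?X (\<lambda>u v. ?\<tau> u v w)" if "w \<in> carrier W" for w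
    by (rule bilinear_precomp[OF pure_bilinear[OF U VW] linear_ident[OF U] pure_linear_left[OF V W that]])
  have lin: "linear_map F W ?X (?\<tau> u v)" if "u \<in> carrier U" "v \<in> carrier V" for u v
    by (rule linear_comp[OF pure_linear_right[OF V W that(2)] pure_linear_right[OF U VW that(1)]])
  note \<beta> = bilinear_tensor_lift[OF U V W X bil lin] and lift_pure = tensor_lift_pure[OF U V X bil]
  have unique: "h (pure F (tensor F U V) W t w) = ?\<beta> t w"
    if h: "linear_map F (tensor F (tensor F U V) W) ?X h"
      "\<forall>u\<in>carrier U. \<forall>v\<in>carrier V. \<forall>w\<in>carrier W. h (pure F (tensor F U V) W (pure F U V u v) w) = ?\<tau> u v w"
      and t: "t \<in> carrier (tensor F U V)" and w: "w \<in> carrier W" for h t w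
    by (rule tensor_linear_eq[OF U V linear_comp[OF pure_linear_left[OF UV W w] h(1)]
          tensor_lift_linear[OF U V X bil[OF w]] _ t])
      (use h(2) w in \<open>auto simp: lift_pure\<close>)
  have *: "(\<And>u v w. u \<in> carrier U \<Longrightarrow> v \<in> carrier V \<Longrightarrow> w \<in> carrier W \<Longrightarrow>
      h (pure F (tensor F U V) W (pure F U V u v) w) = ?\<tau> u v w)"
    if "(\<And>t w. t \<in> carrier (tensor F U V) \<Longrightarrow> w \<in> carrier W \<Longrightarrow> h (pure F (tensor F U V) W t w) = ?\<beta> t w)" for h
    by (simp add: that pure_closed[OF U V] lift_pure)
  note res = tensor_the_linear[OF UV W X \<beta>, of "\<lambda>h. \<forall>u\<in>carrier U. \<forall>v\<in>carrier V. \<forall>w\<in>carrier W.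
      h (pure F (tensor F U V) W (pure F U V u v) w) = ?\<tau> u v w", folded tensor_assoc_def]
  show "linear_map F (tensor F (tensor F U V) W) (tensor F U (tensor F V W)) (tensor_assoc F U V W)"
    by (rule res(2)) (auto simp: * unique)
  show "tensor_assoc F U V W (pure F (tensor F U V) W (pure F U V u v) w)
        = pure F U (tensor F V W) u (pure F V W v w)"
    if "u \<in> carrier U" "v \<in> carrier V" "w \<in> carrier W"
    by (rule *[OF res(3)]) (use that in \<open>auto simp: * unique\<close>)
qed

lemma tensor_assoc_inv:
  assumes U: "vectorspace F U" and V: "vectorspace F V" and W: "vectorspace F W"
  shows tensor_assoc_inv_linear:
      "linear_map F (tensor F U (tensor F V W)) (tensor F (tensor F U V) W) (tensor_assoc_inv F U V W)"
    and tensor_assoc_inv_pure: "u \<in> carrier U \<Longrightarrow> v \<in> carrier V \<Longrightarrow> w \<in> carrier W \<Longrightarrow>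
      tensor_assoc_inv F U V W (pure F U (tensor F V W) u (pure F V W v w))
        = pure F (tensor F U V) W (pure F U V u v) w"
proof -
  let ?X = "tensor F (tensor F U V) W"
  let ?\<tau> = "\<lambda>u v w. pure F (tensor F U V) W (pure F U V u v) w"
  let ?\<beta> = "\<lambda>u t. tensor_lift F V W ?X (\<lambda>v w. ?\<tau> u v w) t"
  note UV = tensor_vectorspace[OF U V] and VW = tensor_vectorspace[OF V W]
  note X = tensor_vectorspace[OF UV W]
  have bil: "bilinear_map F V W ?X (\<lambda>v w. ?\<tau> u v w)" if "u \<in> carrier U" for u
    by (rule bilinear_precomp[OF pure_bilinear[OF UV W] pure_linear_right[OF U V that] linear_ident[OF W]])
  have lin: "linear_map F U ?X (\<lambda>u. ?\<tau> u v w)" if "v \<in> carrier V" "w \<in> carrier W" for v w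
    by (rule linear_comp[OF pure_linear_left[OF U V that(1)] pure_linear_left[OF UV W that(2)]])
  note \<beta> = bilinear_swap[OF bilinear_tensor_lift[OF V W U X bil lin]]
    and lift_pure = tensor_lift_pure[OF V W X bil]
  have unique: "h (pure F U (tensor F V W) u t) = ?\<beta> u t"
    if h: "linear_map F (tensor F U (tensor F V W)) ?X h"
      "\<forall>u\<in>carrier U. \<forall>v\<in>carrier V. \<forall>w\<in>carrier W. h (pure F U (tensor F V W) u (pure F V W v w)) = ?\<tau> u v w"
      and u: "u \<in> carrier U" and t: "t \<in> carrier (tensor F V W)" for h u t
    by (rule tensor_linear_eq[OF V W linear_comp[OF pure_linear_right[OF U VW u] h(1)]
          tensor_lift_linear[OF V W X bil[OF u]] _ t])
      (use h(2) u in \<open>auto simp: lift_pure\<close>)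
  have *: "(\<And>u v w. u \<in> carrier U \<Longrightarrow> v \<in> carrier V \<Longrightarrow> w \<in> carrier W \<Longrightarrow>
      h (pure F U (tensor F V W) u (pure F V W v w)) = ?\<tau> u v w)"
    if "(\<And>u t. u \<in> carrier U \<Longrightarrow> t \<in> carrier (tensor F V W) \<Longrightarrow> h (pure F U (tensor F V W) u t) = ?\<beta> u t)" for h
    by (simp add: that pure_closed[OF V W] lift_pure)
  note res = tensor_the_linear[OF U VW X \<beta>, of "\<lambda>h. \<forall>u\<in>carrier U. \<forall>v\<in>carrier V. \<forall>w\<in>carrier W.
      h (pure F U (tensor F V W) u (pure F V W v w)) = ?\<tau> u v w", folded tensor_assoc_inv_def]
  show "linear_map F (tensor F U (tensor F V W)) (tensor F (tensor F U V) W) (tensor_assoc_inv F U V W)"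
    by (rule res(2)) (auto simp: * unique)
  show "tensor_assoc_inv F U V W (pure F U (tensor F V W) u (pure F V W v w))
        = pure F (tensor F U V) W (pure F U V u v) w"
    if "u \<in> carrier U" "v \<in> carrier V" "w \<in> carrier W"
    by (rule *[OF res(3)]) (use that in \<open>auto simp: * unique\<close>)
qed

text \<open>The value of \<open>\<sigma>\<close> on \<open>v \<otimes> w\<close> is a sum of elementary tensors in general, so the inverse associator
remains in the formula until such a sum is known.\<close>

lemma tensor_left:
  assumes U: "vectorspace F U" and V: "vectorspace F V" and W: "vectorspace F W"
    and V': "vectorspace F V'" and W': "vectorspace F W'"
    and \<sigma>: "linear_map F (tensor F V W) (tensor F V' W') \<sigma>"
  shows tensor_left_linear: "linear_map F (tensor F (tensor F U V) W) (tensor F (tensor F U V') W')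
      (tensor_left F U V W V' W' \<sigma>)"
    and tensor_left_pure: "u \<in> carrier U \<Longrightarrow> v \<in> carrier V \<Longrightarrow> w \<in> carrier W \<Longrightarrow>
      tensor_left F U V W V' W' \<sigma> (pure F (tensor F U V) W (pure F U V u v) w)
        = tensor_assoc_inv F U V' W' (pure F U (tensor F V' W') u (\<sigma> (pure F V W v w)))"
proof -
  note \<sigma>' = tensor_map_linear[OF linear_ident[OF U] \<sigma>]
  show "linear_map F (tensor F (tensor F U V) W) (tensor F (tensor F U V') W')
      (tensor_left F U V W V' W' \<sigma>)"
    unfolding tensor_left_def
    by (rule linear_comp[OF linear_comp[OF tensor_assoc_linear[OF U V W] \<sigma>']
          tensor_assoc_inv_linear[OF U V' W']])
  show "u \<in> carrier U \<Longrightarrow> v \<in> carrier V \<Longrightarrow> w \<in> carrier W \<Longrightarrow>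
      tensor_left F U V W V' W' \<sigma> (pure F (tensor F U V) W (pure F U V u v) w)
        = tensor_assoc_inv F U V' W' (pure F U (tensor F V' W') u (\<sigma> (pure F V W v w)))"
    by (simp add: tensor_left_def tensor_assoc_pure[OF U V W] tensor_map_pure[OF linear_ident[OF U] \<sigma>]
        pure_closed[OF V W])
qed


section \<open>Adjoining a unit\<close>

text \<open>The functional \<open>\<phi>\<close> takes values in the field itself, so its linearity is spelled out in terms of the
field operations; the case of interest is the coefficient of the adjoined unit.\<close>

lemma bilinear_functional:
  assumes W: "vectorspace F W"
    and \<phi>: "\<And>u. u \<in> carrier U \<Longrightarrow> \<phi> u \<in> carrier F"
      "\<And>u u'. u \<in> carrier U \<Longrightarrow> u' \<in> carrier U \<Longrightarrow> \<phi> (u \<oplus>\<^bsub>U\<^esub> u') = \<phi> u \<oplus>\<^bsub>F\<^esub> \<phi> u'"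
      "\<And>c u. c \<in> carrier F \<Longrightarrow> u \<in> carrier U \<Longrightarrow> \<phi> (c \<odot>\<^bsub>U\<^esub> u) = c \<otimes>\<^bsub>F\<^esub> \<phi> u"
    and g: "linear_map F V W g"
  shows "bilinear_map F U V W (\<lambda>u v. \<phi> u \<odot>\<^bsub>W\<^esub> g v)"
proof -
  interpret W: vectorspace F W by (rule W)
  show ?thesis
  proof (rule bilinear_mapI)
    fix c u v assume "c \<in> carrier F" "u \<in> carrier U" "v \<in> carrier V"
    then show "\<phi> u \<odot>\<^bsub>W\<^esub> g (c \<odot>\<^bsub>V\<^esub> v) = c \<odot>\<^bsub>W\<^esub> (\<phi> u \<odot>\<^bsub>W\<^esub> g v)"
      by (simp add: \<phi> linear_closed[OF g] linear_smult[OF g] W.smult_assoc1[symmetric] W.m_comm)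
  qed (simp_all add: \<phi> linear_closed[OF g] linear_add[OF g] W.smult_l_distr W.smult_r_distr W.smult_assoc1)
qed

lemma adjoin_unit_simps:
  "carrier (adjoin_unit F L) = carrier L \<times> carrier F"
  "\<zero>\<^bsub>adjoin_unit F L\<^esub> = (\<zero>\<^bsub>L\<^esub>, \<zero>\<^bsub>F\<^esub>)"
  "x \<oplus>\<^bsub>adjoin_unit F L\<^esub> y = (fst x \<oplus>\<^bsub>L\<^esub> fst y, snd x \<oplus>\<^bsub>F\<^esub> snd y)"
  "c \<odot>\<^bsub>adjoin_unit F L\<^esub> x = (c \<odot>\<^bsub>L\<^esub> fst x, c \<otimes>\<^bsub>F\<^esub> snd x)"
  "bracket (adjoin_unit F L) x y = (bracket L (fst x) (fst y), \<zero>\<^bsub>F\<^esub>)"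
  by (simp_all add: adjoin_unit_def direct_sum_def ground_space_def module.defs)

context
  fixes F :: "('f, 'x) ring_scheme" and L :: "('f, 'v) leibniz"
  assumes L: "vectorspace F L"
begin

interpretation L: vectorspace F L by (rule L)

lemma adjoin_unit_vectorspace: "vectorspace F (adjoin_unit F L)"
proof -
  have "abelian_group (adjoin_unit F L)"
  proof (rule abelian_groupI)
    fix x assume "x \<in> carrier (adjoin_unit F L)"
    then show "\<exists>y\<in>carrier (adjoin_unit F L). y \<oplus>\<^bsub>adjoin_unit F L\<^esub> x = \<zero>\<^bsub>adjoin_unit F L\<^esub>"
      by (intro bexI[of _ "(\<ominus>\<^bsub>L\<^esub> fst x, \<ominus>\<^bsub>F\<^esub> snd x)"]) (auto simp: adjoin_unit_simps L.R.l_neg L.M.l_neg)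
  qed (auto simp: adjoin_unit_simps L.R.a_ac L.M.a_ac)
  then have "module F (adjoin_unit F L)"
    by (intro moduleI L.cring_axioms)
      (auto simp: adjoin_unit_simps L.smult_l_distr L.smult_r_distr L.smult_assoc1 L.l_distr L.r_distr L.m_assoc)
  then show ?thesis by (intro vectorspace.intro L.field_axioms)
qed

lemma emb_linear: "linear_map F L (adjoin_unit F L) (emb F)"
  by (rule linear_mapI) (auto simp: emb_def adjoin_unit_simps L adjoin_unit_vectorspace)

lemma fst_linear: "linear_map F (adjoin_unit F L) L fst"
  by (rule linear_mapI) (auto simp: adjoin_unit_simps L adjoin_unit_vectorspace)

lemma unt_closed: "unt F L \<in> carrier (adjoin_unit F L)"
  by (simp add: unt_def adjoin_unit_simps)

lemma bilinear_snd:
  assumes "linear_map F V W g"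
  shows "bilinear_map F (adjoin_unit F L) V W (\<lambda>x v. snd x \<odot>\<^bsub>W\<^esub> g v)"
  by (rule bilinear_functional[OF linear_cod[OF assms] _ _ _ assms]) (auto simp: adjoin_unit_simps)

lemma adjoin_unit_split:
  "x \<in> carrier (adjoin_unit F L)
    \<Longrightarrow> x = emb F (fst x) \<oplus>\<^bsub>adjoin_unit F L\<^esub> snd x \<odot>\<^bsub>adjoin_unit F L\<^esub> unt F L"
  by (auto simp: adjoin_unit_simps emb_def unt_def)

text \<open>Linear maps on \<open>L\<^sup>+\<close> are compared on \<open>L\<close> and on the unit separately. The descriptions of the braidings and of
the extended action prescribe values on exactly these two kinds of elements.\<close>

lemma adjoin_unit_linear_eq:
  assumes h: "linear_map F (adjoin_unit F L) W h" and h': "linear_map F (adjoin_unit F L) W h'"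
    and emb: "\<And>x. x \<in> carrier L \<Longrightarrow> h (emb F x) = h' (emb F x)" and unt: "h (unt F L) = h' (unt F L)"
    and x: "x \<in> carrier (adjoin_unit F L)"
  shows "h x = h' x"
proof -
  interpret A: vectorspace F "adjoin_unit F L" by (rule adjoin_unit_vectorspace)
  have mem: "fst x \<in> carrier L" "snd x \<in> carrier F" using x by (auto simp: adjoin_unit_simps)
  show ?thesis
    by (subst (1 2) adjoin_unit_split[OF x])
      (simp add: mem linear_add[OF h] linear_add[OF h'] linear_smult[OF h] linear_smult[OF h']
        linear_closed[OF emb_linear] unt_closed emb unt)
qed

end


section \<open>The braidings\<close>

text \<open>All prescribed values of \<open>\<sigma>\<^sub>C\<^sub>,\<^sub>C\<close> are instances of one bilinear formula: on \<open>x \<otimes> y\<close> with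
\<open>x = k + c e\<close> and \<open>y = l + d e\<close> it takes the value \<open>c (d (e \<otimes> e) + e \<otimes> l + l \<otimes> e)\<close>.\<close>

lemma sigma_CC:
  fixes K :: "('f, 'k) leibniz"
  assumes K: "vectorspace F K"
  defines "C \<equiv> adjoin_unit F K"
  shows sigma_CC_linear: "linear_map F (tensor F C C) (tensor F C C) (sigma_CC F K)"
    and sigma_CC_unt_unt: "sigma_CC F K (pure F C C (unt F K) (unt F K)) = pure F C C (unt F K) (unt F K)"
    and sigma_CC_unt_emb: "k \<in> carrier K \<Longrightarrow> sigma_CC F K (pure F C C (unt F K) (emb F k))
      = pure F C C (unt F K) (emb F k) \<oplus>\<^bsub>tensor F C C\<^esub> pure F C C (emb F k) (unt F K)"
    and sigma_CC_emb: "k \<in> carrier K \<Longrightarrow> y \<in> carrier C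
      \<Longrightarrow> sigma_CC F K (pure F C C (emb F k) y) = \<zero>\<^bsub>tensor F C C\<^esub>"
proof -
  interpret K: vectorspace F K by (rule K)
  have C: "vectorspace F C" unfolding C_def by (rule adjoin_unit_vectorspace[OF K])
  interpret C: vectorspace F C by (rule C)
  let ?e = "unt F K" and ?CC = "tensor F C C" and ?p = "pure F C C"
  have CC: "vectorspace F ?CC" by (rule tensor_vectorspace[OF C C])
  interpret CC: vectorspace F ?CC by (rule CC)
  have e: "?e \<in> carrier C" unfolding C_def by (rule unt_closed[OF K])
  have emb: "linear_map F K C (emb F)" and fst: "linear_map F C K fst"
    unfolding C_def by (rule emb_linear[OF K] fst_linear[OF K])+
  note p = pure_closed[OF C C] and pl = pure_linear_left[OF C C] and pr = pure_linear_right[OF C C]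
  note embc = linear_closed[OF emb]
  \<comment> \<open>The value of \<open>\<sigma>\<^sub>C\<^sub>,\<^sub>C\<close> on \<open>e \<otimes> y\<close>, linear in \<open>y\<close>.\<close>
  let ?g = "\<lambda>y. snd y \<odot>\<^bsub>?CC\<^esub> ?p ?e ?e \<oplus>\<^bsub>?CC\<^esub> (?p ?e (emb F (fst y)) \<oplus>\<^bsub>?CC\<^esub> ?p (emb F (fst y)) ?e)"
  let ?\<beta> = "\<lambda>x y. snd x \<odot>\<^bsub>?CC\<^esub> ?g y"
  have snd: "linear_map F C ?CC (\<lambda>y. snd y \<odot>\<^bsub>?CC\<^esub> ?p ?e ?e)"
    using bilinear_snd[OF K linear_ident[OF CC], folded C_def]
    by (rule bilinear_linear_left[OF _ C CC p[OF e e]])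
  have g: "linear_map F C ?CC ?g"
    by (intro linear_plus snd linear_comp[OF linear_comp[OF fst emb] pr[OF e]]
        linear_comp[OF linear_comp[OF fst emb] pl[OF e]])
  have \<beta>: "bilinear_map F C C ?CC ?\<beta>"
    unfolding C_def by (rule bilinear_snd[OF K g[unfolded C_def]])
  have emb0: "emb F \<zero>\<^bsub>K\<^esub> = \<zero>\<^bsub>C\<^esub>" by (rule linear_zero[OF emb])
  have p0: "?p x \<zero>\<^bsub>C\<^esub> = \<zero>\<^bsub>?CC\<^esub>" "?p \<zero>\<^bsub>C\<^esub> x = \<zero>\<^bsub>?CC\<^esub>" if "x \<in> carrier C" for x
    using linear_zero[OF pr[OF that]] linear_zero[OF pl[OF that]] by auto
  have \<beta>_ee: "?\<beta> ?e ?e = ?p ?e ?e"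
    by (simp add: unt_def[of F K] emb0 p e[unfolded unt_def] p0)
  have \<beta>_ek: "?\<beta> ?e (emb F k) = ?p ?e (emb F k) \<oplus>\<^bsub>?CC\<^esub> ?p (emb F k) ?e" if "k \<in> carrier K" for k
    using embc[OF that] e by (simp add: unt_def emb_def p)
  have \<beta>_k: "?\<beta> (emb F k) y = \<zero>\<^bsub>?CC\<^esub>" if "k \<in> carrier K" "y \<in> carrier C" for k y
    using linear_closed[OF g that(2)] by (simp add: emb_def[of F k])
  let ?P = "\<lambda>h. h (?p ?e ?e) = ?p ?e ?e \<and>
       (\<forall>k\<in>carrier K. h (?p ?e (emb F k)) = ?p ?e (emb F k) \<oplus>\<^bsub>?CC\<^esub> ?p (emb F k) ?e) \<and>
       (\<forall>k\<in>carrier K. \<forall>y\<in>carrier C. h (?p (emb F k) y) = \<zero>\<^bsub>?CC\<^esub>)"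
  have P: "?P h" if "\<And>x y. x \<in> carrier C \<Longrightarrow> y \<in> carrier C \<Longrightarrow> h (?p x y) = ?\<beta> x y" for h
    using that e embc \<beta>_ee \<beta>_ek \<beta>_k by simp
  have unique: "h (?p x y) = ?\<beta> x y"
    if h: "linear_map F ?CC ?CC h" and P: "?P h" and x: "x \<in> carrier C" and y: "y \<in> carrier C" for h x y
  proof (rule adjoin_unit_linear_eq[OF K, folded C_def,
        OF linear_comp[OF pl[OF y] h] bilinear_linear_left[OF \<beta> C CC y] _ _ x])
    show "h (?p (emb F k) y) = ?\<beta> (emb F k) y" if "k \<in> carrier K" for k
      using P that y \<beta>_k by simp
    show "h (?p ?e y) = ?\<beta> ?e y"
      by (rule adjoin_unit_linear_eq[OF K, folded C_def,
            OF linear_comp[OF pr[OF e] h] bilinear_linear_right[OF \<beta> C CC e] _ _ y])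
        (use P \<beta>_ee \<beta>_ek in simp_all)
  qed
  have eq: "sigma_CC F K = the_linear F ?CC ?CC ?P"
    by (simp add: sigma_CC_def Let_def C_def)
  note res = tensor_the_linear[OF C C CC \<beta>, of ?P, folded eq]
  show "linear_map F (tensor F C C) (tensor F C C) (sigma_CC F K)"
    by (rule res(2)) (fact P, fact unique)
  have "sigma_CC F K (?p x y) = ?\<beta> x y" if "x \<in> carrier C" "y \<in> carrier C" for x y
    by (rule res(3)) (fact P, fact unique, fact+)
  from P[OF this]
  show "sigma_CC F K (?p ?e ?e) = ?p ?e ?e"
    and "k \<in> carrier K \<Longrightarrow> sigma_CC F K (?p ?e (emb F k)) = ?p ?e (emb F k) \<oplus>\<^bsub>?CC\<^esub> ?p (emb F k) ?e"
    and "k \<in> carrier K \<Longrightarrow> y \<in> carrier C \<Longrightarrow> sigma_CC F K (?p (emb F k) y) = \<zero>\<^bsub>?CC\<^esub>"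
    by blast+
qed

lemma sigma_AA:
  fixes G :: "('f, 'g) leibniz"
  assumes G: "vectorspace F G" and bracket: "bilinear_map F G G G (bracket G)"
  defines "A \<equiv> adjoin_unit F G"
  shows sigma_AA_linear: "linear_map F (tensor F A A) (tensor F A A) (sigma_AA F G)"
    and sigma_AA_pure: "x \<in> carrier A \<Longrightarrow> y \<in> carrier A \<Longrightarrow> sigma_AA F G (pure F A A x y)
      = pure F A A y x \<oplus>\<^bsub>tensor F A A\<^esub> pure F A A (unt F G) (bracket A x y)"
proof -
  have A: "vectorspace F A" unfolding A_def by (rule adjoin_unit_vectorspace[OF G])
  let ?AA = "tensor F A A" and ?p = "pure F A A"
  have AA: "vectorspace F ?AA" by (rule tensor_vectorspace[OF A A])
  have e: "unt F G \<in> carrier A" unfolding A_def by (rule unt_closed[OF G])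
  have emb: "linear_map F G A (emb F)" and fst: "linear_map F A G fst"
    unfolding A_def by (rule emb_linear[OF G] fst_linear[OF G])+
  have br: "bracket A = (\<lambda>x y. emb F (bracket G (fst x) (fst y)))"
    by (intro ext) (simp add: A_def adjoin_unit_simps emb_def)
  have \<beta>: "bilinear_map F A A ?AA (\<lambda>x y. ?p y x \<oplus>\<^bsub>?AA\<^esub> ?p (unt F G) (bracket A x y))"
    unfolding br
    by (rule bilinear_plus[OF AA bilinear_swap[OF pure_bilinear[OF A A]]
          bilinear_postcomp[OF bilinear_postcomp[OF bilinear_precomp[OF bracket fst fst] emb]
            pure_linear_right[OF A A e]]])
  have eq: "sigma_AA F G = the_linear F ?AA ?AA (\<lambda>h. \<forall>x\<in>carrier A. \<forall>y\<in>carrier A.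
       h (?p x y) = ?p y x \<oplus>\<^bsub>?AA\<^esub> ?p (unt F G) (bracket A x y))"
    by (simp add: sigma_AA_def Let_def A_def)
  show "linear_map F (tensor F A A) (tensor F A A) (sigma_AA F G)"
    unfolding eq by (rule tensor_the_linear(2)[OF A A AA \<beta>]; simp)
  show "x \<in> carrier A \<Longrightarrow> y \<in> carrier A \<Longrightarrow> sigma_AA F G (?p x y)
      = ?p y x \<oplus>\<^bsub>?AA\<^esub> ?p (unt F G) (bracket A x y)"
    unfolding eq by (rule tensor_the_linear(3)[OF A A AA \<beta>]; simp)
qed

text \<open>The case distinction in the description of \<open>\<sigma>\<^sub>C\<^sub>,\<^sub>A\<close> disappears when the action is applied to the components
in \<open>K\<close> and \<open>G\<close>: if one argument is a unit, then one of these components is zero and the second summand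
vanishes.\<close>

lemma sigma_CA:
  fixes K :: "('f, 'k) leibniz" and G :: "('f, 'g) leibniz"
  assumes K: "vectorspace F K" and G: "vectorspace F G" and act: "bilinear_map F K G K act"
  defines "C \<equiv> adjoin_unit F K" and "A \<equiv> adjoin_unit F G"
  shows sigma_CA_linear: "linear_map F (tensor F C A) (tensor F A C) (sigma_CA F K G act)"
    and sigma_CA_pure: "x \<in> carrier C \<Longrightarrow> y \<in> carrier A \<Longrightarrow> sigma_CA F K G act (pure F C A x y)
      = pure F A C y x \<oplus>\<^bsub>tensor F A C\<^esub> pure F A C (unt F G) (emb F (act (fst x) (fst y)))"
proof -
  interpret K: vectorspace F K by (rule K)
  interpret G: vectorspace F G by (rule G)
  have C: "vectorspace F C" unfolding C_def by (rule adjoin_unit_vectorspace[OF K])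
  have A: "vectorspace F A" unfolding A_def by (rule adjoin_unit_vectorspace[OF G])
  let ?AC = "tensor F A C" and ?p = "pure F C A" and ?q = "pure F A C"
  have AC: "vectorspace F ?AC" by (rule tensor_vectorspace[OF A C])
  interpret AC: vectorspace F ?AC by (rule AC)
  have e: "unt F G \<in> carrier A" unfolding A_def by (rule unt_closed[OF G])
  have e': "unt F K \<in> carrier C" unfolding C_def by (rule unt_closed[OF K])
  have embK: "linear_map F K C (emb F)" and fstK: "linear_map F C K fst"
    unfolding C_def by (rule emb_linear[OF K] fst_linear[OF K])+
  have embG: "linear_map F G A (emb F)" and fstG: "linear_map F A G fst"
    unfolding A_def by (rule emb_linear[OF G] fst_linear[OF G])+
  let ?\<beta> = "\<lambda>x y. ?q y x \<oplus>\<^bsub>?AC\<^esub> ?q (unt F G) (emb F (act (fst x) (fst y)))"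
  have \<beta>: "bilinear_map F C A ?AC ?\<beta>"
    by (rule bilinear_plus[OF AC bilinear_swap[OF pure_bilinear[OF A C]]
          bilinear_postcomp[OF bilinear_postcomp[OF bilinear_precomp[OF act fstK fstG] embK]
            pure_linear_right[OF A C e]]])
  let ?P = "\<lambda>h. (\<forall>x\<in>carrier C. \<forall>y\<in>carrier A. x = unt F K \<or> y = unt F G \<longrightarrow> h (?p x y) = ?q y x) \<and>
       (\<forall>k\<in>carrier K. \<forall>g\<in>carrier G. h (?p (emb F k) (emb F g))
            = ?q (emb F g) (emb F k) \<oplus>\<^bsub>?AC\<^esub> ?q (unt F G) (emb F (act k g)))"
  have act0: "g \<in> carrier G \<Longrightarrow> act \<zero>\<^bsub>K\<^esub> g = \<zero>\<^bsub>K\<^esub>" "k \<in> carrier K \<Longrightarrow> act k \<zero>\<^bsub>G\<^esub> = \<zero>\<^bsub>K\<^esub>" for k g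
    using linear_zero[OF bilinear_linear_left[OF act K K]]
      linear_zero[OF bilinear_linear_right[OF act G K]] by auto
  have q0: "?q (unt F G) (emb F \<zero>\<^bsub>K\<^esub>) = \<zero>\<^bsub>?AC\<^esub>"
    by (rule linear_zero[OF linear_comp[OF embK pure_linear_right[OF A C e]]])
  have \<beta>_unt: "?\<beta> x y = ?q y x" if "x \<in> carrier C" "y \<in> carrier A" "x = unt F K \<or> y = unt F G" for x y
  proof -
    have "act (fst x) (fst y) = \<zero>\<^bsub>K\<^esub>"
      using that linear_closed[OF fstK that(1)] linear_closed[OF fstG that(2)]
      by (auto simp: unt_def act0)
    then show ?thesis using that by (simp add: q0 pure_closed[OF A C])
  qed
  have \<beta>_emb: "?\<beta> (emb F k) (emb F g) = ?q (emb F g) (emb F k) \<oplus>\<^bsub>?AC\<^esub> ?q (unt F G) (emb F (act k g))" for k g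
    by (simp add: emb_def)
  have P: "?P h" if "\<And>x y. x \<in> carrier C \<Longrightarrow> y \<in> carrier A \<Longrightarrow> h (?p x y) = ?\<beta> x y" for h
    using that \<beta>_unt \<beta>_emb linear_closed[OF embK] linear_closed[OF embG] by auto
  have unique: "h (?p x y) = ?\<beta> x y"
    if h: "linear_map F (tensor F C A) ?AC h" and P: "?P h" and x: "x \<in> carrier C" and y: "y \<in> carrier A"
    for h x y
  proof (rule adjoin_unit_linear_eq[OF K, folded C_def,
        OF linear_comp[OF pure_linear_left[OF C A y] h] bilinear_linear_left[OF \<beta> C AC y] _ _ x])
    fix k assume k: "k \<in> carrier K"
    note ek = linear_closed[OF embK k]
    show "h (?p (emb F k) y) = ?\<beta> (emb F k) y"
    proof (rule adjoin_unit_linear_eq[OF G, folded A_def,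
          OF linear_comp[OF pure_linear_right[OF C A ek] h] bilinear_linear_right[OF \<beta> A AC ek] _ _ y])
      show "h (?p (emb F k) (emb F g)) = ?\<beta> (emb F k) (emb F g)" if "g \<in> carrier G" for g
        using P that k unfolding \<beta>_emb by blast
      show "h (?p (emb F k) (unt F G)) = ?\<beta> (emb F k) (unt F G)"
        using P ek e by (subst \<beta>_unt) auto
    qed
  next
    show "h (?p (unt F K) y) = ?\<beta> (unt F K) y"
      using P e' y by (subst \<beta>_unt) auto
  qed
  have eq: "sigma_CA F K G act = the_linear F (tensor F C A) ?AC ?P"
    by (simp add: sigma_CA_def Let_def C_def A_def)
  show "linear_map F (tensor F C A) (tensor F A C) (sigma_CA F K G act)"
    unfolding eq by (rule tensor_the_linear(2)[OF C A AC \<beta>]) (fact P, fact unique)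
  show "sigma_CA F K G act (?p x y) = ?\<beta> x y" if "x \<in> carrier C" "y \<in> carrier A"
    unfolding eq by (rule tensor_the_linear(3)[OF C A AC \<beta>]) (fact P, fact unique, fact+)
qed


section \<open>Extending actions and coactions\<close>

lemma extend_act:
  fixes G :: "('f, 'g) leibniz" and M :: "('f, 'm) module"
  assumes M: "vectorspace F M" and G: "vectorspace F G" and a: "bilinear_map F M G M (curry a)"
  defines "A \<equiv> adjoin_unit F G"
  shows extend_act_extensional: "extend_act F G M a \<in> extensional (carrier (tensor F M A))"
    and extend_act_linear: "linear_map F (tensor F M A) M (extend_act F G M a)"
    and extend_act_pure: "m \<in> carrier M \<Longrightarrow> x \<in> carrier A \<Longrightarrow>
      extend_act F G M a (pure F M A m x) = a (m, fst x) \<oplus>\<^bsub>M\<^esub> snd x \<odot>\<^bsub>M\<^esub> m"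
proof -
  interpret M: vectorspace F M by (rule M)
  have A: "vectorspace F A" unfolding A_def by (rule adjoin_unit_vectorspace[OF G])
  have e: "unt F G \<in> carrier A" unfolding A_def by (rule unt_closed[OF G])
  have emb: "linear_map F G A (emb F)" and fst: "linear_map F A G fst"
    unfolding A_def by (rule emb_linear[OF G] fst_linear[OF G])+
  let ?\<beta> = "\<lambda>m x. curry a m (fst x) \<oplus>\<^bsub>M\<^esub> snd x \<odot>\<^bsub>M\<^esub> m"
  have "bilinear_map F M A M (\<lambda>m x. snd x \<odot>\<^bsub>M\<^esub> m)"
    unfolding A_def by (rule bilinear_swap[OF bilinear_snd[OF G linear_ident[OF M]]])
  then have \<beta>: "bilinear_map F M A M ?\<beta>"
    by (rule bilinear_plus[OF M bilinear_precomp[OF a linear_ident[OF M] fst]])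
  let ?P = "\<lambda>h. \<forall>m\<in>carrier M. h (pure F M A m (unt F G)) = m \<and>
       (\<forall>g\<in>carrier G. h (pure F M A m (emb F g)) = a (m, g))"
  have \<beta>_unt: "?\<beta> m (unt F G) = m" if "m \<in> carrier M" for m
    using that linear_zero[OF bilinear_linear_right[OF a G M that]] by (simp add: unt_def)
  have \<beta>_emb: "?\<beta> m (emb F g) = a (m, g)" if "m \<in> carrier M" "g \<in> carrier G" for m g
    using that bilinear_closed[OF a that] by (simp add: emb_def)
  have P: "?P h" if "\<And>m x. m \<in> carrier M \<Longrightarrow> x \<in> carrier A \<Longrightarrow> h (pure F M A m x) = ?\<beta> m x" for h
    using that e linear_closed[OF emb] \<beta>_unt \<beta>_emb by simp
  have unique: "h (pure F M A m x) = ?\<beta> m x"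
    if h: "linear_map F (tensor F M A) M h" and P: "?P h" and m: "m \<in> carrier M" and x: "x \<in> carrier A"
    for h m x
    by (rule adjoin_unit_linear_eq[OF G, folded A_def,
        OF linear_comp[OF pure_linear_right[OF M A m] h] bilinear_linear_right[OF \<beta> A M m] _ _ x])
      (use P m \<beta>_unt \<beta>_emb in simp_all)
  have eq: "extend_act F G M a = the_linear F (tensor F M A) M ?P"
    by (simp add: extend_act_def Let_def A_def)
  show "extend_act F G M a \<in> extensional (carrier (tensor F M A))"
    unfolding eq by (rule tensor_the_linear(1)[OF M A M \<beta>]) (fact P, fact unique)
  show "linear_map F (tensor F M A) M (extend_act F G M a)"
    unfolding eq by (rule tensor_the_linear(2)[OF M A M \<beta>]) (fact P, fact unique)
  have "extend_act F G M a (pure F M A m x) = ?\<beta> m x" if "m \<in> carrier M" "x \<in> carrier A"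
    unfolding eq by (rule tensor_the_linear(3)[OF M A M \<beta>]) (fact P, fact unique, fact+)
  then show "m \<in> carrier M \<Longrightarrow> x \<in> carrier A \<Longrightarrow>
      extend_act F G M a (pure F M A m x) = a (m, fst x) \<oplus>\<^bsub>M\<^esub> snd x \<odot>\<^bsub>M\<^esub> m"
    by simp
qed

lemma diagonal_act:
  assumes M: "vectorspace F M" and K: "vectorspace F K"
    and a: "linear_map F M M (\<lambda>m. a (m, g))" and act: "linear_map F K K (\<lambda>k. act k g)"
  shows diagonal_act_linear: "linear_map F (tensor F M K) (tensor F M K) (\<lambda>t. diagonal_act F M K a act t g)"
    and diagonal_act_pure: "m \<in> carrier M \<Longrightarrow> k \<in> carrier K \<Longrightarrow>
      diagonal_act F M K a act (pure F M K m k) g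
        = pure F M K m (act k g) \<oplus>\<^bsub>tensor F M K\<^esub> pure F M K (a (m, g)) k"
proof -
  let ?\<beta> = "\<lambda>m k. pure F M K m (act k g) \<oplus>\<^bsub>tensor F M K\<^esub> pure F M K (a (m, g)) k"
  note MK = tensor_vectorspace[OF M K] and p = pure_bilinear[OF M K]
  have \<beta>: "bilinear_map F M K (tensor F M K) ?\<beta>"
    by (rule bilinear_plus[OF MK bilinear_precomp[OF p linear_ident[OF M] act]
          bilinear_precomp[OF p a linear_ident[OF K]]])
  have eq: "(\<lambda>t. diagonal_act F M K a act t g) = tensor_lift F M K (tensor F M K) ?\<beta>"
    by (simp add: diagonal_act_def tensor_lift_def)
  show "linear_map F (tensor F M K) (tensor F M K) (\<lambda>t. diagonal_act F M K a act t g)"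
    unfolding eq by (rule tensor_lift_linear[OF M K MK \<beta>])
  show "m \<in> carrier M \<Longrightarrow> k \<in> carrier K \<Longrightarrow> diagonal_act F M K a act (pure F M K m k) g = ?\<beta> m k"
    using tensor_lift_pure[OF M K MK \<beta>] by (simp add: eq[THEN fun_cong])
qed


section \<open>From representations to Yetter-Drinfeld modules\<close>

lemma tensor_map_cong:
  assumes "\<And>u. u \<in> carrier U \<Longrightarrow> f u = f' u"
  shows "tensor_map F U V U' V' f g = tensor_map F U V U' V' f' g"
proof -
  have "(\<forall>u\<in>carrier U. \<forall>v\<in>carrier V. h (pure F U V u v) = pure F U' V' (f u) (g v)) \<longleftrightarrow>
    (\<forall>u\<in>carrier U. \<forall>v\<in>carrier V. h (pure F U V u v) = pure F U' V' (f' u) (g v))" for h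
    using assms by auto
  then show ?thesis by (simp add: tensor_map_def)
qed

text \<open>A representation given by its three components. Extensionality of the structure maps matters for the
equality of objects, not for the calculations in the locale; \<open>rep_iff\<close> adds it.\<close>

locale crossed_module_rep = crossed_module F K G \<pi> act
  for F :: "('f, 'x) ring_scheme" and K :: "('f, 'k) leibniz" and G :: "('f, 'g) leibniz"
    and \<pi> :: "'k \<Rightarrow> 'g" and act :: "'k \<Rightarrow> 'g \<Rightarrow> 'k" +
  fixes M :: "('f, 'm) module" and a :: "'m \<times> 'g \<Rightarrow> 'm" and \<delta>0 :: "'m \<Rightarrow> ('m \<times> 'k \<Rightarrow> 'f) set"
  assumes M: "vectorspace F M"
    and action: "leibniz_action F G M (curry a)"
    and \<delta>0: "linear_map F M (tensor F M K) \<delta>0"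
    and \<delta>0_square: "m \<in> carrier M \<Longrightarrow>
      tensor_map F M K (tensor F M K) K \<delta>0 (\<lambda>k. k) (\<delta>0 m) = \<zero>\<^bsub>tensor F (tensor F M K) K\<^esub>"
    and \<delta>0_equivariant: "m \<in> carrier M \<Longrightarrow> g \<in> carrier G \<Longrightarrow>
      \<delta>0 (a (m, g)) = diagonal_act F M K a act (\<delta>0 m) g"
begin

abbreviation "C \<equiv> adjoin_unit F K"
abbreviation "A \<equiv> adjoin_unit F G"
abbreviation "eC \<equiv> unt F K"
abbreviation "eA \<equiv> unt F G"
abbreviation "MK \<equiv> tensor F M K"
abbreviation "MC \<equiv> tensor F M C"
abbreviation "MA \<equiv> tensor F M A"
abbreviation "\<rho> \<equiv> extend_act F G M a"
abbreviation "\<delta> \<equiv> extend_coact F K M \<delta>0"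
abbreviation "\<iota> \<equiv> tensor_map F M K M C (\<lambda>m. m) (emb F)"

lemma K: "vectorspace F K" and G: "vectorspace F G"
  by unfold_locales

lemma C: "vectorspace F C" and A: "vectorspace F A"
  by (rule adjoin_unit_vectorspace K G)+

lemma MK: "vectorspace F MK" and MC: "vectorspace F MC" and MA: "vectorspace F MA"
  by (rule tensor_vectorspace M K C A)+

lemma MCC: "vectorspace F (tensor F MC C)"
  by (rule tensor_vectorspace MC C)+

sublocale M: vectorspace F M by (rule M)
sublocale MK: vectorspace F MK by (rule MK)
sublocale MC: vectorspace F MC by (rule MC)
sublocale MCC: vectorspace F "tensor F MC C" by (rule MCC)

lemma a_bilinear: "bilinear_map F M G M (curry a)"
  using action by (simp add: leibniz_action_def)

lemma a_bracket: "m \<in> carrier M \<Longrightarrow> g \<in> carrier G \<Longrightarrow> g' \<in> carrier G \<Longrightarrow>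
    a (m, bracket G g g') = a (a (m, g), g') \<ominus>\<^bsub>M\<^esub> a (a (m, g'), g)"
  using action by (simp add: leibniz_action_def)

lemmas a_simps = bilinear_mapD[OF a_bilinear, unfolded curry_def]

lemma a_zero: "m \<in> carrier M \<Longrightarrow> a (m, \<zero>\<^bsub>G\<^esub>) = \<zero>\<^bsub>M\<^esub>"
  using linear_zero[OF bilinear_linear_right[OF a_bilinear G M]] by simp

lemma act_bilinear: "bilinear_map F K G K act"
  using act_action by (simp add: leibniz_action_def)

lemma diagonal:
  assumes "g \<in> carrier G"
  shows diagonal_linear: "linear_map F MK MK (\<lambda>t. diagonal_act F M K a act t g)"
    and diagonal_pure: "m \<in> carrier M \<Longrightarrow> k \<in> carrier K \<Longrightarrow>
      diagonal_act F M K a act (pure F M K m k) g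
        = pure F M K m (act k g) \<oplus>\<^bsub>MK\<^esub> pure F M K (a (m, g)) k"
proof -
  have "linear_map F M M (\<lambda>m. a (m, g))"
    using bilinear_linear_left[OF a_bilinear M M assms] by simp
  from diagonal_act[where a = a and act = act and g = g, OF M K this bilinear_linear_left[OF act_bilinear K K assms]]
  show "linear_map F MK MK (\<lambda>t. diagonal_act F M K a act t g)"
    and "m \<in> carrier M \<Longrightarrow> k \<in> carrier K \<Longrightarrow>
      diagonal_act F M K a act (pure F M K m k) g
        = pure F M K m (act k g) \<oplus>\<^bsub>MK\<^esub> pure F M K (a (m, g)) k"
    by blast+
qed

lemmas eC_closed = unt_closed[OF K] and eA_closed = unt_closed[OF G]
  and embK = emb_linear[OF K] and embG = emb_linear[OF G]

lemma fst_closed: "x \<in> carrier A \<Longrightarrow> fst x \<in> carrier G" "x \<in> carrier A \<Longrightarrow> snd x \<in> carrier F"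
  by (auto simp: adjoin_unit_simps)

lemmas \<rho>_linear = extend_act_linear[OF M G a_bilinear]
  and \<rho>_pure = extend_act_pure[OF M G a_bilinear]

lemma \<rho>_unt: "m \<in> carrier M \<Longrightarrow> \<rho> (pure F M A m eA) = m"
  using eA_closed by (simp add: \<rho>_pure) (simp add: unt_def a_zero)

lemma \<rho>_emb: "m \<in> carrier M \<Longrightarrow> g \<in> carrier G \<Longrightarrow> \<rho> (pure F M A m (emb F g)) = a (m, g)"
  using linear_closed[OF embG] by (simp add: \<rho>_pure) (simp add: emb_def a_simps)

lemmas \<iota>_linear = tensor_map_linear[OF linear_ident[OF M] embK]
  and \<iota>_pure = tensor_map_pure[OF linear_ident[OF M] embK]

text \<open>The first projection \<open>K\<^sup>+ \<rightarrow> K\<close> is a left inverse of the inclusion \<open>K \<rightarrow> K\<^sup>+\<close>, and tensoring with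
\<open>M\<close> preserves this.\<close>

lemma \<iota>_inj:
  assumes "s \<in> carrier MK" "t \<in> carrier MK" "\<iota> s = \<iota> t"
  shows "s = t"
proof -
  have "tensor_map F M C M K (\<lambda>m. m) fst (\<iota> t) = t" if "t \<in> carrier MK" for t
    using tensor_map_comp[OF linear_ident[OF M] embK linear_ident[OF M] fst_linear[OF K] that]
      tensor_map_ident[OF M K _ _ that, of "\<lambda>m. m" "\<lambda>k. fst (emb F k)"]
    by (simp add: emb_def)
  with assms show ?thesis by metis
qed

lemma \<delta>_eq: "m \<in> carrier M \<Longrightarrow> \<delta> m = \<iota> (\<delta>0 m) \<oplus>\<^bsub>MC\<^esub> pure F M C m eC"
  by (simp add: extend_coact_def Let_def)

lemma \<delta>_linear: "linear_map F M MC \<delta>"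
  by (rule linear_map_cong[OF linear_plus[OF linear_comp[OF \<delta>0 \<iota>_linear]
          pure_linear_left[OF M C eC_closed]]]) (rule \<delta>_eq)

lemmas pMC = pure_closed[OF M C] and pMA = pure_closed[OF M A]
  and pMCC = pure_closed[OF MC C] and pMAA = pure_closed[OF MA A] and pMAC = pure_closed[OF MA C]

text \<open>For \<open>x = g + c e\<close> and \<open>y = h + d e\<close>, both sides consist of the same mixed terms together with
\<open>(m * g) * h\<close> on the left and \<open>(m * h) * g + m * [g, h]\<close> on the right; these are equal by the Leibniz
action identity.\<close>

lemma \<rho>_braided:
  defines "T \<equiv> tensor_map F MA A M A \<rho> (\<lambda>a. a)"
  assumes t: "t \<in> carrier (tensor F MA A)"
  shows "\<rho> (T t) = \<rho> (T (tensor_left F M A A A A (sigma_AA F G) t))"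
proof -
  note \<sigma> = sigma_AA_linear[OF G G.bracket_bilinear] and \<sigma>_pure = sigma_AA_pure[OF G G.bracket_bilinear]
  note T = tensor_map_linear[OF \<rho>_linear linear_ident[OF A], folded T_def]
    and T_pure = tensor_map_pure[OF \<rho>_linear linear_ident[OF A], folded T_def]
  note S = tensor_left_linear[OF M A A A A \<sigma>] and S_pure = tensor_left_pure[OF M A A A A \<sigma>]
  note assoc = tensor_assoc_inv_linear[OF M A A] and assoc_pure = tensor_assoc_inv_pure[OF M A A]
  have pAA: "linear_map F (tensor F A A) (tensor F M (tensor F A A)) (pure F M (tensor F A A) m)"
    if "m \<in> carrier M" for m
    by (rule pure_linear_right[OF M tensor_vectorspace[OF A A] that])
  show ?thesis
  proof (rule tensor_left_nested_linear_eq[OF M A A linear_comp[OF T \<rho>_linear]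
        linear_comp[OF linear_comp[OF S T] \<rho>_linear] _ t])
    fix m x y assume m: "m \<in> carrier M" and x: "x \<in> carrier A" and y: "y \<in> carrier A"
    have br: "bracket A x y \<in> carrier A"
      using fst_closed x y bilinear_closed[OF G.bracket_bilinear] by (auto simp: adjoin_unit_simps)
    note mem = m x y br eA_closed pMA linear_closed[OF \<rho>_linear] pure_closed[OF A A]
    have "tensor_left F M A A A A (sigma_AA F G) (pure F MA A (pure F M A m x) y)
      = tensor_assoc_inv F M A A (pure F M (tensor F A A) m
          (pure F A A y x \<oplus>\<^bsub>tensor F A A\<^esub> pure F A A eA (bracket A x y)))"
      by (simp add: S_pure \<sigma>_pure mem)
    also have "\<dots> = pure F MA A (pure F M A m y) x
        \<oplus>\<^bsub>tensor F MA A\<^esub> pure F MA A (pure F M A m eA) (bracket A x y)"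
      by (simp add: linear_add[OF pAA] linear_add[OF assoc] linear_closed[OF pAA] assoc_pure mem)
    finally have "\<rho> (T (tensor_left F M A A A A (sigma_AA F G) (pure F MA A (pure F M A m x) y)))
      = \<rho> (pure F M A (\<rho> (pure F M A m y)) x) \<oplus>\<^bsub>M\<^esub> \<rho> (pure F M A m (bracket A x y))"
      by (simp add: linear_add[OF T] linear_add[OF \<rho>_linear] T_pure \<rho>_unt mem pMAA)
    also have "\<dots> = \<rho> (pure F M A (\<rho> (pure F M A m x)) y)"
    proof -
      obtain g c h d where xy: "x = (g, c)" "y = (h, d)" by (cases x, cases y)
      have gc: "g \<in> carrier G" "c \<in> carrier F" "h \<in> carrier G" "d \<in> carrier F"
        using fst_closed x y by (auto simp: xy)
      \<comment> \<open>The Leibniz identity contributes \<open>p - q\<close>, whose second term removes the unwanted \<open>q = (m * h) * g\<close>.\<close>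
      have cancel: "(q \<oplus>\<^bsub>M\<^esub> u) \<oplus>\<^bsub>M\<^esub> (p \<ominus>\<^bsub>M\<^esub> q) = p \<oplus>\<^bsub>M\<^esub> u"
        if "p \<in> carrier M" "q \<in> carrier M" "u \<in> carrier M" for p q u
      proof -
        have "(q \<oplus>\<^bsub>M\<^esub> u) \<oplus>\<^bsub>M\<^esub> (p \<ominus>\<^bsub>M\<^esub> q) = (p \<oplus>\<^bsub>M\<^esub> u) \<oplus>\<^bsub>M\<^esub> (q \<oplus>\<^bsub>M\<^esub> \<ominus>\<^bsub>M\<^esub> q)"
          using that by (simp add: a_minus_def M.M.a_ac)
        then show ?thesis using that by (simp add: M.M.r_neg)
      qed
      have "\<rho> (pure F M A (\<rho> (pure F M A m y)) x) \<oplus>\<^bsub>M\<^esub> \<rho> (pure F M A m (bracket A x y))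
        = (a (a (m, h), g) \<oplus>\<^bsub>M\<^esub> (d \<odot>\<^bsub>M\<^esub> a (m, g) \<oplus>\<^bsub>M\<^esub> (c \<odot>\<^bsub>M\<^esub> a (m, h) \<oplus>\<^bsub>M\<^esub> c \<odot>\<^bsub>M\<^esub> (d \<odot>\<^bsub>M\<^esub> m))))
          \<oplus>\<^bsub>M\<^esub> (a (a (m, g), h) \<ominus>\<^bsub>M\<^esub> a (a (m, h), g))"
        using gc x y br m by (simp add: \<rho>_pure xy adjoin_unit_simps(5) a_bracket a_simps M.smult_r_distr M.M.a_assoc)
      also have "\<dots> = a (a (m, g), h) \<oplus>\<^bsub>M\<^esub>
          (d \<odot>\<^bsub>M\<^esub> a (m, g) \<oplus>\<^bsub>M\<^esub> (c \<odot>\<^bsub>M\<^esub> a (m, h) \<oplus>\<^bsub>M\<^esub> c \<odot>\<^bsub>M\<^esub> (d \<odot>\<^bsub>M\<^esub> m)))"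
        using gc m by (intro cancel) (simp_all add: a_simps)
      also have "\<dots> = \<rho> (pure F M A (\<rho> (pure F M A m x)) y)"
        using gc x y m
        by (simp add: \<rho>_pure xy a_simps M.smult_r_distr M.M.a_ac M.smult_assoc1[symmetric] K.m_comm)
      finally show ?thesis .
    qed
    also have "\<dots> = \<rho> (T (pure F MA A (pure F M A m x) y))"
      by (simp add: T_pure mem)
    finally show "\<rho> (T (pure F MA A (pure F M A m x) y))
      = \<rho> (T (tensor_left F M A A A A (sigma_AA F G) (pure F MA A (pure F M A m x) y)))"
      by simp
  qed
qed

text \<open>The iterated coaction is split into the three summands that the braiding treats differently. In Sweedler notation they
are \<open>m\<^sub>0 \<otimes> e \<otimes> m\<^sub>1\<close>, \<open>m\<^sub>0 \<otimes> m\<^sub>1 \<otimes> e\<close> and \<open>m \<otimes> e \<otimes> e\<close>. The effect of the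
braiding on the first two is linear in \<open>m\<^sub>0 \<otimes> m\<^sub>1\<close>, so it is computed for an arbitrary
tensor \<open>n \<otimes> k\<close> in place of \<open>\<delta>\<^sub>0(m)\<close>.\<close>

lemma \<delta>_braided:
  defines "D \<equiv> tensor_map F M C MC C \<delta> (\<lambda>c. c)"
  assumes m: "m \<in> carrier M"
  shows "D (\<delta> m) = tensor_left F M C C C C (sigma_CC F K) (D (\<delta> m))"
proof -
  let ?S = "tensor_left F M C C C C (sigma_CC F K)"
  let ?MCC = "tensor F MC C"
  define D0 where "D0 = tensor_map F M K MK K \<delta>0 (\<lambda>k. k)"
  \<comment> \<open>\<open>J\<close> places \<open>M \<otimes> K \<otimes> K\<close> inside \<open>M \<otimes> C \<otimes> C\<close>; \<open>\<Phi>\<close> inserts the unit in the middle: \<open>n \<otimes> k \<mapsto> n \<otimes> e \<otimes> k\<close>.\<close>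
  define J where "J = tensor_map F MK K MC C \<iota> (emb F)"
  define \<Phi> where "\<Phi> = tensor_map F M K MC C (\<lambda>n. pure F M C n eC) (emb F)"
  note \<sigma> = sigma_CC_linear[OF K]
  note D = tensor_map_linear[OF \<delta>_linear linear_ident[OF C], folded D_def]
    and D_pure = tensor_map_pure[OF \<delta>_linear linear_ident[OF C], folded D_def]
  note D0 = tensor_map_linear[OF \<delta>0 linear_ident[OF K], folded D0_def]
    and D0_pure = tensor_map_pure[OF \<delta>0 linear_ident[OF K], folded D0_def]
  note J = tensor_map_linear[OF \<iota>_linear embK, folded J_def]
    and J_pure = tensor_map_pure[OF \<iota>_linear embK, folded J_def]
  note pe = pure_linear_left[OF M C eC_closed] and pe' = pure_linear_left[OF MC C eC_closed]
  note \<Phi> = tensor_map_linear[OF pe embK, folded \<Phi>_def] and \<Phi>_pure = tensor_map_pure[OF pe embK, folded \<Phi>_def]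
  note S = tensor_left_linear[OF M C C C C \<sigma>] and S_pure = tensor_left_pure[OF M C C C C \<sigma>]
  note assoc = tensor_assoc_inv_linear[OF M C C] and assoc_pure = tensor_assoc_inv_pure[OF M C C]
  have pCC: "linear_map F (tensor F C C) (tensor F M (tensor F C C)) (pure F M (tensor F C C) m)"
    if "m \<in> carrier M" for m
    by (rule pure_linear_right[OF M tensor_vectorspace[OF C C] that])
  note mem = eC_closed pMC pMCC pure_closed[OF C C] linear_closed[OF embK] linear_closed[OF \<delta>_linear]
    linear_closed[OF \<delta>0] linear_closed[OF \<iota>_linear]
  have D_\<iota>: "D (\<iota> t) = J (D0 t) \<oplus>\<^bsub>?MCC\<^esub> \<Phi> t" if t: "t \<in> carrier MK" for t
    by (rule tensor_linear_eq[OF M K linear_comp[OF \<iota>_linear D] linear_plus[OF linear_comp[OF D0 J] \<Phi>] _ t])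
      (simp add: \<iota>_pure D_pure D0_pure J_pure \<Phi>_pure mem \<delta>_eq pure_add_left[OF MC C])
  have S_\<Phi>: "?S (\<Phi> t) = \<Phi> t \<oplus>\<^bsub>?MCC\<^esub> pure F MC C (\<iota> t) eC" if t: "t \<in> carrier MK" for t
    by (rule tensor_linear_eq[OF M K linear_comp[OF \<Phi> S] linear_plus[OF \<Phi> linear_comp[OF \<iota>_linear pe']] _ t])
      (simp add: \<iota>_pure \<Phi>_pure S_pure sigma_CC_unt_emb[OF K] mem linear_add[OF pCC] linear_add[OF assoc]
        linear_closed[OF pCC] assoc_pure)
  have S_\<iota>: "?S (pure F MC C (\<iota> t) eC) = \<zero>\<^bsub>?MCC\<^esub>" if t: "t \<in> carrier MK" for t
    by (rule tensor_linear_eq[OF M K linear_comp[OF linear_comp[OF \<iota>_linear pe'] S]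
          linear_const_zero[OF MK MCC] _ t])
      (simp add: \<iota>_pure S_pure sigma_CC_emb[OF K] mem linear_zero[OF pCC] linear_zero[OF assoc])
  have S_e: "?S (pure F MC C (pure F M C m eC) eC) = pure F MC C (pure F M C m eC) eC"
    using m by (simp add: S_pure sigma_CC_unt_unt[OF K] mem assoc_pure)
  have "D (\<delta> m) = D (\<iota> (\<delta>0 m)) \<oplus>\<^bsub>?MCC\<^esub> D (pure F M C m eC)"
    using m by (simp add: \<delta>_eq linear_add[OF D] mem)
  also have "D (\<iota> (\<delta>0 m)) = \<Phi> (\<delta>0 m)"
    using m \<delta>0_square[OF m, folded D0_def]
    by (simp add: D_\<iota> mem linear_zero[OF J] linear_closed[OF \<Phi>])
  also have "D (pure F M C m eC) = pure F MC C (\<iota> (\<delta>0 m)) eC \<oplus>\<^bsub>?MCC\<^esub> pure F MC C (pure F M C m eC) eC"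
    using m by (simp add: D_pure mem \<delta>_eq pure_add_left[OF MC C])
  finally have eq: "D (\<delta> m) = \<Phi> (\<delta>0 m) \<oplus>\<^bsub>?MCC\<^esub>
      (pure F MC C (\<iota> (\<delta>0 m)) eC \<oplus>\<^bsub>?MCC\<^esub> pure F MC C (pure F M C m eC) eC)" .
  \<comment> \<open>The zero summand is the image of the term ending in \<open>m\<^sub>1 \<otimes> e\<close>; it is kept to match the three images.\<close>
  have "?S (D (\<delta> m)) = (\<Phi> (\<delta>0 m) \<oplus>\<^bsub>?MCC\<^esub> pure F MC C (\<iota> (\<delta>0 m)) eC)
      \<oplus>\<^bsub>?MCC\<^esub> (\<zero>\<^bsub>?MCC\<^esub> \<oplus>\<^bsub>?MCC\<^esub> pure F MC C (pure F M C m eC) eC)"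
    unfolding eq using m
    by (simp add: linear_add[OF S] linear_closed[OF \<Phi>] mem S_\<Phi> S_\<iota> S_e del: MCC.M.l_zero)
  also have "\<dots> = D (\<delta> m)"
    unfolding eq using m by (simp add: MCC.M.a_assoc linear_closed[OF \<Phi>] mem)
  finally show ?thesis by simp
qed

text \<open>On \<open>\<iota>(s) \<otimes> (g + c e)\<close> the right-hand composite gives the diagonal action of \<open>g\<close> on \<open>s\<close> plus
\<open>c \<iota>(s)\<close>; on \<open>m \<otimes> e \<otimes> x\<close> it gives \<open>(m \<sqdot> x) \<otimes> e\<close>, because the unit of \<open>K\<^sup>+\<close> has no component
in \<open>K\<close> on which \<open>x\<close> could act. For \<open>s = \<delta>\<^sub>0(m)\<close>, equivariance of \<open>\<delta>\<^sub>0\<close> identifies the sum with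
the coaction of \<open>m \<sqdot> x\<close>.\<close>

lemma \<delta>_\<rho>:
  defines "E \<equiv> tensor_map F MA C M C \<rho> (\<lambda>c. c)"
    and "S \<equiv> tensor_left F M C A A C (sigma_CA F K G act)"
    and "T \<equiv> tensor_map F M A MC A \<delta> (\<lambda>a. a)"
  assumes t: "t \<in> carrier MA"
  shows "\<delta> (\<rho> t) = E (S (T t))"
proof -
  note \<sigma> = sigma_CA_linear[OF K G act_bilinear] and \<sigma>_pure = sigma_CA_pure[OF K G act_bilinear]
  note E = tensor_map_linear[OF \<rho>_linear linear_ident[OF C], folded E_def]
    and E_pure = tensor_map_pure[OF \<rho>_linear linear_ident[OF C], folded E_def]
  note T = tensor_map_linear[OF \<delta>_linear linear_ident[OF A], folded T_def]
    and T_pure = tensor_map_pure[OF \<delta>_linear linear_ident[OF A], folded T_def]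
  note S = tensor_left_linear[OF M C A A C \<sigma>, folded S_def]
    and S_pure = tensor_left_pure[OF M C A A C \<sigma>, folded S_def]
  note assoc = tensor_assoc_inv_linear[OF M A C] and assoc_pure = tensor_assoc_inv_pure[OF M A C]
  have pAC: "linear_map F (tensor F A C) (tensor F M (tensor F A C)) (pure F M (tensor F A C) m)"
    if "m \<in> carrier M" for m
    by (rule pure_linear_right[OF M tensor_vectorspace[OF A C] that])
  note mem = eC_closed eA_closed fst_closed pMC pMA pMAC pure_closed[OF MC A] pure_closed[OF A C] pure_closed[OF M K]
    linear_closed[OF embK] linear_closed[OF \<delta>_linear] linear_closed[OF \<rho>_linear]
    linear_closed[OF \<delta>0] linear_closed[OF \<iota>_linear] bilinear_closed[OF act_bilinear] a_simps(1)
  have S_pure': "S (pure F MC A (pure F M C n y) x) = pure F MA C (pure F M A n x) y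
      \<oplus>\<^bsub>tensor F MA C\<^esub> pure F MA C (pure F M A n eA) (emb F (act (fst y) (fst x)))"
    if "n \<in> carrier M" "y \<in> carrier C" "x \<in> carrier A" for n y x
    using that linear_closed[OF fst_linear[OF K] that(2)]
    by (simp add: S_pure \<sigma>_pure mem linear_add[OF pAC] linear_add[OF assoc] linear_closed[OF pAC] assoc_pure)
  have ES: "E (S (pure F MC A (pure F M C n y) x)) = pure F M C (\<rho> (pure F M A n x)) y
      \<oplus>\<^bsub>MC\<^esub> pure F M C n (emb F (act (fst y) (fst x)))"
    if "n \<in> carrier M" "y \<in> carrier C" "x \<in> carrier A" for n y x
    using that linear_closed[OF fst_linear[OF K] that(2)]
    by (simp add: S_pure' linear_add[OF E] E_pure \<rho>_unt mem)
  have ES_\<iota>: "E (S (pure F MC A (\<iota> s) x)) = \<iota> (diagonal_act F M K a act s (fst x)) \<oplus>\<^bsub>MC\<^esub> snd x \<odot>\<^bsub>MC\<^esub> \<iota> s"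
    if x: "x \<in> carrier A" and s: "s \<in> carrier MK" for x s
  proof (rule tensor_linear_eq[OF M K
        linear_comp[OF linear_comp[OF linear_comp[OF \<iota>_linear pure_linear_left[OF MC A x]] S] E]
        linear_plus[OF linear_comp[OF diagonal_linear \<iota>_linear] linear_scale[OF \<iota>_linear]] _ s])
    fix n k assume n: "n \<in> carrier M" and k: "k \<in> carrier K"
    have "fst (emb F k) = k" by (simp add: emb_def)
    then show "E (S (pure F MC A (\<iota> (pure F M K n k)) x)) =
       \<iota> (diagonal_act F M K a act (pure F M K n k) (fst x)) \<oplus>\<^bsub>MC\<^esub> snd x \<odot>\<^bsub>MC\<^esub> \<iota> (pure F M K n k)"
      using n k x
      by (simp add: \<iota>_pure ES \<rho>_pure diagonal_pure linear_add[OF \<iota>_linear] mem pure_add_left[OF M C]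
          pure_smult_left[OF M C] MC.M.a_ac)
  qed (use fst_closed x in auto)
  have ES_e: "E (S (pure F MC A (pure F M C m eC) x)) = pure F M C (\<rho> (pure F M A m x)) eC"
    if "m \<in> carrier M" "x \<in> carrier A" for m x
  proof -
    have "act (fst eC) (fst x) = \<zero>\<^bsub>K\<^esub>"
      using linear_zero[OF bilinear_linear_left[OF act_bilinear K K]] that by (simp add: unt_def mem)
    then show ?thesis
      using that linear_zero[OF embK] linear_zero[OF pure_linear_right[OF M C]]
      by (simp add: ES mem)
  qed
  show ?thesis
  proof (rule tensor_linear_eq[OF M A linear_comp[OF \<rho>_linear \<delta>_linear]
        linear_comp[OF linear_comp[OF T S] E] _ t])
    fix m x assume m: "m \<in> carrier M" and x: "x \<in> carrier A"
    have "E (S (T (pure F M A m x))) = E (S (pure F MC A (\<iota> (\<delta>0 m)) x \<oplus>\<^bsub>tensor F MC A\<^esub>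
        pure F MC A (pure F M C m eC) x))"
      using m x by (simp add: T_pure \<delta>_eq mem pure_add_left[OF MC A])
    also have "\<dots> = (\<iota> (\<delta>0 (a (m, fst x))) \<oplus>\<^bsub>MC\<^esub> snd x \<odot>\<^bsub>MC\<^esub> \<iota> (\<delta>0 m))
        \<oplus>\<^bsub>MC\<^esub> pure F M C (\<rho> (pure F M A m x)) eC"
      using m x by (simp add: linear_add[OF S] linear_add[OF E] linear_closed[OF S] mem ES_\<iota> ES_e \<delta>0_equivariant)
    also have "\<dots> = \<delta> (\<rho> (pure F M A m x))"
      using m x by (simp add: \<delta>_eq mem) (simp add: \<rho>_pure linear_add[OF \<delta>0] linear_smult[OF \<delta>0]
          linear_add[OF \<iota>_linear] linear_smult[OF \<iota>_linear] mem)
    finally show "\<delta> (\<rho> (pure F M A m x)) = E (S (T (pure F M A m x)))" by simp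
  qed
qed

lemma \<delta>_extensional: "\<delta> \<in> extensional (carrier M)"
  by (simp add: extend_coact_def Let_def)

end

lemma (in crossed_module) rep_iff:
  "is_rep F K G act R \<longleftrightarrow>
    crossed_module_rep F K G \<pi> act (rep_space R) (rep_act R) (rep_coact R) \<and>
    rep_act R \<in> extensional (carrier (rep_space R) \<times> carrier G) \<and>
    rep_coact R \<in> extensional (carrier (rep_space R))"
  using crossed_module_axioms
  by (auto simp: is_rep_def Let_def crossed_module_rep_def crossed_module_rep_axioms_def)

lemma (in crossed_module) rep_to_yd_is_yd:
  assumes "is_rep F K G act R"
  shows "is_yd F (adjoin_unit F K) (adjoin_unit F G) (sigma_CC F K) (sigma_AA F G) (sigma_CA F K G act)
    (rep_to_yd F K G R)"
proof -
  interpret crossed_module_rep F K G \<pi> act "rep_space R" "rep_act R" "rep_coact R"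
    using assms rep_iff by blast
  show ?thesis
    using M extend_act_extensional[OF M G a_bilinear] \<rho>_linear \<delta>_extensional \<delta>_linear \<rho>_braided \<delta>_braided \<delta>_\<rho>
    by (simp add: is_yd_def rep_to_yd_def Let_def)
qed

text \<open>Commuting with the action of the unit is automatic for a linear map, and so is commuting with the summand
\<open>m \<otimes> e\<close> of the coaction. What remains is compatibility with \<open>*\<close> and, after cancelling the injective map
\<open>\<iota>\<close>, with \<open>\<delta>\<^sub>0\<close>.\<close>

lemma (in crossed_module) rep_hom_eq_yd_hom:
  assumes R: "is_rep F K G act R" and R': "is_rep F K G act R'"
  shows "rep_hom F K G R R'
    = yd_hom F (adjoin_unit F K) (adjoin_unit F G) (rep_to_yd F K G R) (rep_to_yd F K G R')"
proof -
  let ?M = "rep_space R" and ?M' = "rep_space R'"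
  interpret R: crossed_module_rep F K G \<pi> act ?M "rep_act R" "rep_coact R"
    using R rep_iff by blast
  interpret R': crossed_module_rep F K G \<pi> act ?M' "rep_act R'" "rep_coact R'"
    using R' rep_iff by blast
  have act_iff: "(\<forall>m\<in>carrier ?M. \<forall>g\<in>carrier G. f (rep_act R (m, g)) = rep_act R' (f m, g)) \<longleftrightarrow>
      (\<forall>t\<in>carrier R.MA. f (R.\<rho> t) = R'.\<rho> (tensor_map F ?M R.A ?M' R.A f (\<lambda>a. a) t))"
    (is "?L \<longleftrightarrow> ?R") if f: "linear_map F ?M ?M' f" for f
  proof
    note fA = tensor_map_linear[OF f linear_ident[OF R.A]]
      and fA_pure = tensor_map_pure[OF f linear_ident[OF R.A]]
    show ?R if ?L
    proof
      fix t assume t: "t \<in> carrier R.MA"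
      show "f (R.\<rho> t) = R'.\<rho> (tensor_map F ?M R.A ?M' R.A f (\<lambda>a. a) t)"
        by (rule tensor_linear_eq[OF R.M R.A linear_comp[OF R.\<rho>_linear f] linear_comp[OF fA R'.\<rho>_linear] _ t])
          (use \<open>?L\<close> in \<open>simp add: R.\<rho>_pure fA_pure R'.\<rho>_pure linear_closed[OF f] linear_add[OF f]
            linear_smult[OF f] R.fst_closed R.a_simps(1)\<close>)
    qed
    show ?L if ?R
    proof (intro ballI)
      fix m g assume m: "m \<in> carrier ?M" and g: "g \<in> carrier G"
      note eg = linear_closed[OF R.embG g]
      have "f (R.\<rho> (pure F ?M R.A m (emb F g)))
          = R'.\<rho> (tensor_map F ?M R.A ?M' R.A f (\<lambda>a. a) (pure F ?M R.A m (emb F g)))"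
        using \<open>?R\<close> R.pMA[OF m eg] by blast
      then show "f (rep_act R (m, g)) = rep_act R' (f m, g)"
        using m g eg by (simp add: R.\<rho>_emb R'.\<rho>_emb fA_pure linear_closed[OF f])
    qed
  qed
  have coact_iff: "rep_coact R' (f m) = tensor_map F ?M K ?M' K f (\<lambda>k. k) (rep_coact R m) \<longleftrightarrow>
      R'.\<delta> (f m) = tensor_map F ?M R.C ?M' R.C f (\<lambda>c. c) (R.\<delta> m)"
    if f: "linear_map F ?M ?M' f" and m: "m \<in> carrier ?M" for f m
  proof -
    note fK = tensor_map_linear[OF f linear_ident[OF R.K]]
    note fC = tensor_map_linear[OF f linear_ident[OF R.C]]
      and fC_pure = tensor_map_pure[OF f linear_ident[OF R.C]]
    note mem = m linear_closed[OF f] linear_closed[OF R.\<delta>0] linear_closed[OF R'.\<delta>0] linear_closed[OF fK]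
      linear_closed[OF R'.\<iota>_linear] linear_closed[OF R.\<iota>_linear] R.pMC R'.pMC R.eC_closed
    have "tensor_map F ?M R.C ?M' R.C f (\<lambda>c. c) (R.\<iota> (rep_coact R m))
        = R'.\<iota> (tensor_map F ?M K ?M' K f (\<lambda>k. k) (rep_coact R m))"
      using mem by (simp add: tensor_map_comp[OF linear_ident[OF R.M] R.embK f linear_ident[OF R.C]]
          tensor_map_comp[OF f linear_ident[OF R.K] linear_ident[OF R'.M] R.embK])
    then have "tensor_map F ?M R.C ?M' R.C f (\<lambda>c. c) (R.\<delta> m)
        = R'.\<iota> (tensor_map F ?M K ?M' K f (\<lambda>k. k) (rep_coact R m)) \<oplus>\<^bsub>R'.MC\<^esub> pure F ?M' R.C (f m) R.eC"
      using mem by (simp add: R.\<delta>_eq linear_add[OF fC] fC_pure)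
    moreover have "R'.\<delta> (f m) = R'.\<iota> (rep_coact R' (f m)) \<oplus>\<^bsub>R'.MC\<^esub> pure F ?M' R.C (f m) R.eC"
      using mem by (simp add: R'.\<delta>_eq)
    ultimately show ?thesis
      using mem R'.\<iota>_inj[of "rep_coact R' (f m)" "tensor_map F ?M K ?M' K f (\<lambda>k. k) (rep_coact R m)"]
      by auto
  qed
  show ?thesis
    by (simp add: rep_hom_def yd_hom_def rep_to_yd_def Let_def act_iff coact_iff cong: conj_cong ball_cong_simp)
qed

text \<open>The action of \<open>g\<close> is recovered by evaluating the extended action on \<open>m \<otimes> g\<close>, and \<open>\<delta>\<^sub>0(m)\<close> is
recovered from \<open>\<iota>(\<delta>\<^sub>0(m)) = \<delta>(m) - m \<otimes> e\<close>. Equal values on the carriers give equal maps because the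
structure maps are extensional.\<close>

lemma (in crossed_module) rep_to_yd_inj: "inj_on (rep_to_yd F K G) {R. is_rep F K G act R}"
proof (rule inj_onI, unfold mem_Collect_eq)
  fix R R' :: "('f, 'm, 'k, 'g) rep"
  assume R: "is_rep F K G act R" and R': "is_rep F K G act R'" and eq: "rep_to_yd F K G R = rep_to_yd F K G R'"
  let ?M = "rep_space R"
  from eq have space: "rep_space R' = ?M"
    and act: "extend_act F G ?M (rep_act R) = extend_act F G ?M (rep_act R')"
    and coact: "extend_coact F K ?M (rep_coact R) = extend_coact F K ?M (rep_coact R')"
    by (auto simp: rep_to_yd_def)
  interpret R: crossed_module_rep F K G \<pi> act ?M "rep_act R" "rep_coact R"
    using R rep_iff by blast
  interpret R': crossed_module_rep F K G \<pi> act ?M "rep_act R'" "rep_coact R'"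
    using R' rep_iff space by metis
  have "rep_act R = rep_act R'"
  proof (rule extensionalityI[of _ "carrier ?M \<times> carrier G"])
    show "rep_act R \<in> extensional (carrier ?M \<times> carrier G)" "rep_act R' \<in> extensional (carrier ?M \<times> carrier G)"
      using R R' rep_iff space by metis+
    fix x assume "x \<in> carrier ?M \<times> carrier G"
    then show "rep_act R x = rep_act R' x"
      using R.\<rho>_emb R'.\<rho>_emb act by (cases x) (metis mem_Sigma_iff)
  qed
  moreover have "rep_coact R = rep_coact R'"
  proof (rule extensionalityI[of _ "carrier ?M"])
    show "rep_coact R \<in> extensional (carrier ?M)" "rep_coact R' \<in> extensional (carrier ?M)"
      using R R' rep_iff space by metis+
    fix m assume m: "m \<in> carrier ?M"
    have "R.\<iota> (rep_coact R m) \<oplus>\<^bsub>R.MC\<^esub> pure F ?M R.C m R.eC = R.\<iota> (rep_coact R' m) \<oplus>\<^bsub>R.MC\<^esub> pure F ?M R.C m R.eC"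
      using coact m by (simp flip: R.\<delta>_eq R'.\<delta>_eq)
    then have "R.\<iota> (rep_coact R m) = R.\<iota> (rep_coact R' m)"
      using m R.pMC[OF m R.eC_closed] linear_closed[OF R.\<iota>_linear linear_closed[OF R.\<delta>0 m]]
        linear_closed[OF R.\<iota>_linear linear_closed[OF R'.\<delta>0 m]] by simp
    then show "rep_coact R m = rep_coact R' m"
      using R.\<iota>_inj m linear_closed[OF R.\<delta>0] linear_closed[OF R'.\<delta>0] by blast
  qed
  ultimately show "R = R'" using space by simp
qed


section \<open>The two categories\<close>

lemma linear_compose:
  assumes "linear_map F U V f" "linear_map F V W g"
  shows "linear_map F U W (compose (carrier U) g f)"
  by (rule linear_map_cong[OF linear_comp[OF assms]]) (simp add: compose_def)

lemma linear_restrict_ident: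
  assumes "vectorspace F V"
  shows "linear_map F V V (\<lambda>x\<in>carrier V. x)"
  by (rule linear_map_cong[OF linear_ident[OF assms]]) simp

lemma tensor_map_compose:
  assumes f: "linear_map F U U' f" and g: "linear_map F U' U'' g" and V: "vectorspace F V"
    and t: "t \<in> carrier (tensor F U V)"
  shows "tensor_map F U V U'' V (compose (carrier U) g f) (\<lambda>v. v) t
    = tensor_map F U' V U'' V g (\<lambda>v. v) (tensor_map F U V U' V f (\<lambda>v. v) t)"
proof -
  have "tensor_map F U V U'' V (compose (carrier U) g f) (\<lambda>v. v)
      = tensor_map F U V U'' V (\<lambda>u. g (f u)) (\<lambda>v. v)"
    by (rule tensor_map_cong) (simp add: compose_def)
  then show ?thesis by (simp add: tensor_map_comp[OF f linear_ident[OF V] g linear_ident[OF V] t])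
qed

lemma tensor_map_restrict_ident:
  assumes "vectorspace F U" "vectorspace F V" "t \<in> carrier (tensor F U V)"
  shows "tensor_map F U V U V (\<lambda>u\<in>carrier U. u) (\<lambda>v. v) t = t"
  by (rule tensor_map_ident[OF assms(1,2) _ _ assms(3)]) simp_all

text \<open>Both categories compose morphisms as functions on underlying sets, so the unit and associativity laws are those
of extensional functions and only closure of the hom-sets has to be checked.\<close>

lemma concrete_category:
  assumes ident: "\<And>a. a \<in> Ob X \<Longrightarrow> (\<lambda>m\<in>S a. m) \<in> Hom X a a"
    and comp: "\<And>a b c g f. \<lbrakk>a \<in> Ob X; b \<in> Ob X; c \<in> Ob X; g \<in> Hom X b c; f \<in> Hom X a b\<rbrakk>
      \<Longrightarrow> compose (S a) g f \<in> Hom X a c"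
    and maps: "\<And>a b f. f \<in> Hom X a b \<Longrightarrow> f \<in> extensional (S a) \<and> f \<in> S a \<rightarrow> S b"
    and Id: "\<And>a. Id X a = (\<lambda>m\<in>S a. m)"
    and Comp: "\<And>a b c g f. Comp X a b c g f = compose (S a) g f"
  shows "category X"
proof
  fix a b c d h g f
  assume "h \<in> Hom X c d" "g \<in> Hom X b c" "f \<in> Hom X a b"
  then show "Comp X a b d (Comp X b c d h g) f = Comp X a c d h (Comp X a b c g f)"
    unfolding Comp using maps by (intro compose_assoc[symmetric]) blast
next
  fix a b f assume "f \<in> Hom X a b"
  from maps[OF this] show "Comp X a a b f (Id X a) = f" "Comp X a b b (Id X b) f = f"
    unfolding Id Comp by (auto intro: compose_Id Id_compose)
qed (simp_all add: ident comp Id Comp)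

lemma YD_category:
  assumes C: "vectorspace F C" and A: "vectorspace F A"
  shows "category (YD F C A \<sigma>CC \<sigma>AA \<sigma>CA)"
proof (rule concrete_category[where S = "\<lambda>Y. carrier (yd_space Y)"])
  let ?X = "YD F C A \<sigma>CC \<sigma>AA \<sigma>CA"
  have yd: "vectorspace F (yd_space Y)" "linear_map F (tensor F (yd_space Y) A) (yd_space Y) (yd_act Y)"
    "linear_map F (yd_space Y) (tensor F (yd_space Y) C) (yd_coact Y)" if "Y \<in> Ob ?X" for Y
    using that by (simp_all add: YD_def is_yd_def Let_def)
  show "(\<lambda>m\<in>carrier (yd_space Y). m) \<in> Hom ?X Y Y" if Y: "Y \<in> Ob ?X" for Y
    using linear_closed[OF yd(2)[OF Y]] linear_closed[OF yd(3)[OF Y]]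
    by (simp add: YD_def yd_hom_def Let_def linear_restrict_ident[OF yd(1)[OF Y]]
        tensor_map_restrict_ident[OF yd(1)[OF Y] A] tensor_map_restrict_ident[OF yd(1)[OF Y] C])
  show "compose (carrier (yd_space Y)) g f \<in> Hom ?X Y Y''"
    if Y: "Y \<in> Ob ?X" and "Y' \<in> Ob ?X" "Y'' \<in> Ob ?X" and g: "g \<in> Hom ?X Y' Y''" and f: "f \<in> Hom ?X Y Y'"
    for Y Y' Y'' g f
  proof -
    let ?M = "yd_space Y" and ?M' = "yd_space Y'" and ?M'' = "yd_space Y''"
    have fl: "linear_map F ?M ?M' f" and gl: "linear_map F ?M' ?M'' g"
      using f g by (simp_all add: YD_def yd_hom_def Let_def)
    note lin = linear_closed[OF fl] linear_closed[OF yd(2)[OF Y]] linear_closed[OF yd(3)[OF Y]]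
      linear_closed[OF tensor_map_linear[OF fl linear_ident[OF A]]]
    show ?thesis
      using f g lin
      by (simp add: YD_def yd_hom_def Let_def linear_compose[OF fl gl] tensor_map_compose[OF fl gl A]
          tensor_map_compose[OF fl gl C] compose_eq)
  qed
qed (auto simp: YD_def yd_hom_def Let_def linear_closed)

lemma Rep_category:
  fixes K :: "('f, 'k) leibniz" and G :: "('f, 'g) leibniz"
  assumes K: "vectorspace F K"
  shows "category (Rep F K G act :: (('f, 'm, 'k, 'g) rep, 'm \<Rightarrow> 'm) cat)"
proof (rule concrete_category[where S = "\<lambda>R. carrier (rep_space R)"])
  let ?X = "Rep F K G act :: (('f, 'm, 'k, 'g) rep, 'm \<Rightarrow> 'm) cat"
  have rep: "vectorspace F (rep_space R)" "bilinear_map F (rep_space R) G (rep_space R) (curry (rep_act R))"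
    "linear_map F (rep_space R) (tensor F (rep_space R) K) (rep_coact R)" if "R \<in> Ob ?X" for R
    using that by (simp_all add: Rep_def is_rep_def Let_def leibniz_action_def)
  show "(\<lambda>m\<in>carrier (rep_space R). m) \<in> Hom ?X R R" if R: "R \<in> Ob ?X" for R
    using bilinear_closed[OF rep(2)[OF R]] linear_closed[OF rep(3)[OF R]]
    by (simp add: Rep_def rep_hom_def Let_def linear_restrict_ident[OF rep(1)[OF R]]
        tensor_map_restrict_ident[OF rep(1)[OF R] K])
  show "compose (carrier (rep_space R)) g f \<in> Hom ?X R R''"
    if R: "R \<in> Ob ?X" and "R' \<in> Ob ?X" "R'' \<in> Ob ?X" and g: "g \<in> Hom ?X R' R''" and f: "f \<in> Hom ?X R R'"
    for R R' R'' g f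
  proof -
    let ?M = "rep_space R" and ?M' = "rep_space R'" and ?M'' = "rep_space R''"
    have fl: "linear_map F ?M ?M' f" and gl: "linear_map F ?M' ?M'' g"
      using f g by (simp_all add: Rep_def rep_hom_def Let_def)
    note lin = linear_closed[OF fl] bilinear_closed[OF rep(2)[OF R]] linear_closed[OF rep(3)[OF R]]
    show ?thesis
      using f g lin
      by (simp add: Rep_def rep_hom_def Let_def linear_compose[OF fl gl] tensor_map_compose[OF fl gl K]
          compose_eq)
  qed
qed (auto simp: Rep_def rep_hom_def Let_def linear_closed)

theorem proposition4p10:
  fixes F :: "('f, 'x) ring_scheme" and K :: "('f, 'k) leibniz" and G :: "('f, 'g) leibniz"
    and \<pi> :: "'k \<Rightarrow> 'g" and act :: "'k \<Rightarrow> 'g \<Rightarrow> 'k"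
  assumes "crossed_module F K G \<pi> act"
  shows "category_inclusion
    (Rep F K G act :: (('f, 'm, 'k, 'g) rep, 'm \<Rightarrow> 'm) cat)
    (YD_plus F K G act)
    (rep_to_yd F K G)
    (\<lambda>R R' f. f)"
proof -
  interpret crossed_module F K G \<pi> act by fact
  let ?X = "Rep F K G act :: (('f, 'm, 'k, 'g) rep, 'm \<Rightarrow> 'm) cat" and ?Y = "YD_plus F K G act"
  have K: "vectorspace F K" and G: "vectorspace F G" by unfold_locales
  have hom: "Hom ?X R R' = Hom ?Y (rep_to_yd F K G R) (rep_to_yd F K G R')"
    if "R \<in> Ob ?X" "R' \<in> Ob ?X" for R R'
    using that rep_hom_eq_yd_hom by (simp add: Rep_def YD_plus_def YD_def)
  interpret X: category ?X by (rule Rep_category[OF K])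
  interpret Y: category ?Y
    unfolding YD_plus_def by (rule YD_category) (rule adjoin_unit_vectorspace K G)+
  show ?thesis
  proof unfold_locales
    show "rep_to_yd F K G R \<in> Ob ?Y" if "R \<in> Ob ?X" for R
      using that rep_to_yd_is_yd by (simp add: Rep_def YD_plus_def YD_def)
    show "inj_on (rep_to_yd F K G) (Ob ?X)"
      using rep_to_yd_inj by (simp add: Rep_def)
  qed (auto simp: hom bij_betw_def, auto simp: Rep_def YD_plus_def YD_def rep_to_yd_def)
qed

end
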